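(* Every countable icc group $G$ admits a free, metrizable, proximal $G$-flow.
   Context: A group is icc if every non-identity element has an infinite conjugacy class. A $G$-flow is a compact Hausdorff space with an action of $G$ by homeomorphisms; it is free if every point has trivial stabilizer. A $G$-flow $X$ is proximal if for all $x_1,x_2\in X$ there exist $y\in X$ and a net $(g_i)$ in $G$ with $g_ix_1\to y$ and $g_ix_2\to y$. *)

theory Defs
  imports "HOL-Analysis.Analysis" "HOL-Algebra.Group"
begin

definition icc_group :: "('g, 'm) monoid_scheme \<Rightarrow> bool" where
  "icc_group G \<longleftrightarrow> group G \<and>
     (\<forall>g\<in>carrier G. g \<noteq> \<one>\<^bsub>G\<^esub> \<longrightarrow>
        infinite {inv\<^bsub>G\<^esub> h \<otimes>\<^bsub>G\<^esub> g \<otimes>\<^bsub>G\<^esub> h | h. h \<in> carrier G})"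

definition group_flow :: "('g, 'm) monoid_scheme \<Rightarrow> 'x topology \<Rightarrow> ('g \<Rightarrow> 'x \<Rightarrow> 'x) \<Rightarrow> bool" where
  "group_flow G X a \<longleftrightarrow> group G \<and> topspace X \<noteq> {} \<and> compact_space X \<and> Hausdorff_space X \<and>
     (\<forall>g\<in>carrier G. homeomorphic_map X X (a g)) \<and>
     (\<forall>x\<in>topspace X. a \<one>\<^bsub>G\<^esub> x = x) \<and>
     (\<forall>g\<in>carrier G. \<forall>h\<in>carrier G. \<forall>x\<in>topspace X. a (g \<otimes>\<^bsub>G\<^esub> h) x = a g (a h x))"

definition free_flow :: "('g, 'm) monoid_scheme \<Rightarrow> 'x topology \<Rightarrow> ('g \<Rightarrow> 'x \<Rightarrow> 'x) \<Rightarrow> bool" where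
  "free_flow G X a \<longleftrightarrow>
     (\<forall>x\<in>topspace X. {g \<in> carrier G. a g x = x} = {\<one>\<^bsub>G\<^esub>})"

text \<open>Proximal: any two points can be brought together along a common net in G.
  Nets are represented, as usual in Isabelle, by proper filters on the group
  (eventually concentrated on the carrier).\<close>
definition proximal_flow :: "('g, 'm) monoid_scheme \<Rightarrow> 'x topology \<Rightarrow> ('g \<Rightarrow> 'x \<Rightarrow> 'x) \<Rightarrow> bool" where
  "proximal_flow G X a \<longleftrightarrow>
     (\<forall>x1\<in>topspace X. \<forall>x2\<in>topspace X. \<exists>y\<in>topspace X. \<exists>F :: 'g filter.
        F \<noteq> bot \<and> eventually (\<lambda>g. g \<in> carrier G) F \<and>
        limitin X (\<lambda>g. a g x1) y F \<and> limitin X (\<lambda>g. a g x2) y F)"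

end

theory Submission
  imports Defs "HOL-Algebra.Coset"
begin

text \<open>
  For every \<open>g \<noteq> 1\<close> we build a subshift of proper 3-colourings of the graph \<open>h \<sim> hg\<close>; on it \<open>g\<close> has no fixed
  point. Finite patterns \<open>P\<^sub>n\<close> with growing domains and finite sets \<open>B\<^sub>n\<close> are chosen so that in every
  configuration \<open>P\<^sub>n\<close> occurs somewhere in each translate \<open>h B\<^sub>n\<close>, while \<open>P\<^sub>n\<^sub>+\<^sub>1\<close> contains \<open>P\<^sub>n\<close> at all places of
  \<open>B\<^sub>n\<close>. Given two configurations, the first has \<open>P\<^sub>n\<close> on a whole translate \<open>u B\<^sub>n\<close> and the second has it
  somewhere in \<open>u B\<^sub>n\<close>, so they agree on a large window, uniformly over all pairs; hence the subshift,
  and the product of all of these subshifts, is proximal. The two demands on \<open>B\<^sub>n\<close> are compatible because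
  in an icc group \<open>B\<^sub>n\<close> can be chosen with \<open>b\<inverse> h b\<close> far from the identity for \<open>h \<noteq> 1\<close> and almost all
  \<open>b \<in> B\<^sub>n\<close>; the configurations themselves come from a local lemma argument.
\<close>

section \<open>A counting local lemma\<close>

text \<open>The demands on \<open>B\<close> pull against each other. Copies of \<open>p\<close> on
  all of \<open>B\<close> occupy the space near every \<open>b\<close>. If all conjugates of some
  \<open>h \<noteq> \<one>\<close> by elements of \<open>B\<close> stayed near the identity, every
  \<open>h \<otimes> b\<close> would lie close to \<open>b\<close>, and the translate of
  \<open>B\<close> by \<open>h\<close> could be completely blocked without containing a copy of
  \<open>p\<close>. Genericity of \<open>B\<close> rules this out.

  Extending a pattern means inserting copies of \<open>p\<close> into many overlapping translates at
  once, far from each other and without crowding any further translate. A random choice achieves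
  this for one translate, the local lemma for all of them. Its parameter \<open>m\<close> depends
  only on a finite neighbourhood \<open>E\<close> of the identity, so the size of \<open>B\<close>
  is known before \<open>B\<close> is chosen.

  Each subshift is free for its own \<open>g\<close> only; hence the product. Proximality of the
  factors would not suffice there: a translation that aligns one factor changes the pair seen in the
  others, so the windows must be fixed before that pair is known. This is the reason for agreement
  uniform over all pairs.\<close>

lemma restrict_eq_restrict_iff: "restrict x A = restrict y A \<longleftrightarrow> (\<forall>v\<in>A. x v = y v)"
  by (metis restrict_apply' restrict_ext)

text \<open>Rosenfeld's counting form of the local lemma: adding one vertex multiplies the number of
  good colourings by almost \<open>q\<close>.\<close>

lemma local_lemma_counting:
  fixes e :: "'i \<Rightarrow> 'v set" and bad :: "'i \<Rightarrow> ('v \<Rightarrow> nat) \<Rightarrow> bool" and q N M :: nat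
  assumes finI: "finite I" and q: "0 < q"
    and fin: "\<And>i. i \<in> I \<Longrightarrow> finite (e i)" and N: "\<And>i. i \<in> I \<Longrightarrow> card (e i) = N" and "0 < N"
    and deg: "\<And>v. card {i \<in> I. v \<in> e i} \<le> M"
    and dep: "\<And>i x y. i \<in> I \<Longrightarrow> (\<And>v. v \<in> e i \<Longrightarrow> x v = y v) \<Longrightarrow> bad i x \<Longrightarrow> bad i y"
    and few: "\<And>i. i \<in> I \<Longrightarrow> card {x \<in> e i \<rightarrow>\<^sub>E {..<q}. bad i x} * (4 * N * M) \<le> q ^ N"
  shows "\<exists>x. (\<forall>v. x v < q) \<and> (\<forall>i\<in>I. \<not> bad i x)"
proof -
  \<comment> \<open>Only edges wholly inside \<open>S\<close> are tested, so restrictions of good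
    colourings stay good.\<close>
  define Good where "Good S = {x \<in> S \<rightarrow>\<^sub>E {..<q}. \<forall>i\<in>I. e i \<subseteq> S \<longrightarrow> \<not> bad i x}" for S
  \<comment> \<open>The factor is chosen so that, by Bernoulli, \<open>N - 1\<close> steps still
    keep half of the naive growth \<open>q ^ (N - 1)\<close>.\<close>
  define \<beta> :: real where "\<beta> = q * (1 - 1 / (2 * N))"
  have half: "1 / (2 * real N) \<le> 1/2" using \<open>0 < N\<close> by (simp add: field_simps)
  have \<beta>0: "\<beta> > 0" using q half unfolding \<beta>_def by (intro mult_pos_pos) auto
  have \<beta>pow: "\<beta> ^ (N - 1) \<ge> q ^ (N - 1) / 2"
  proof -
    have "(1 + (- 1 / (2 * real N))) ^ (N - 1) \<ge> 1 + real (N - 1) * (- 1 / (2 * real N))"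
      using half by (intro Bernoulli_inequality) auto
    moreover have "real (N - 1) * (1 / (2 * real N)) \<le> 1 / 2"
      using \<open>0 < N\<close> by (simp add: field_simps)
    ultimately have "(1 - 1 / (2 * real N)) ^ (N - 1) \<ge> 1 / 2" by simp
    then have "q ^ (N - 1) * (1 - 1 / (2 * real N)) ^ (N - 1) \<ge> q ^ (N - 1) * (1 / 2)"
      by (intro mult_left_mono) auto
    then show ?thesis by (simp add: \<beta>_def power_mult_distrib)
  qed
  have finGood: "finite (Good S)" if "finite S" for S
    unfolding Good_def using that by (auto intro!: finite_PiE)
  have restr: "restrict x T \<in> Good T" if "x \<in> Good S" "T \<subseteq> S" for x S T
    using that dep[of _ "restrict x T" x] unfolding Good_def
    by (auto simp: PiE_iff subset_iff)
  \<comment> \<open>Strong induction on the size. A colouring of \<open>insert v S\<close> spoiled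
    by the edge \<open>i\<close> is determined by its values on \<open>e i\<close> and on
    \<open>S - e i\<close>, and the growth known for smaller sets compares
    \<open>Good (S - e i)\<close> with \<open>Good S\<close>.\<close>
  have step: "\<beta> * card (Good S) \<le> card (Good (insert v S))" if "finite S" "v \<notin> S" for S v
    using that
  proof (induction "card S" arbitrary: S v rule: less_induct)
    case less
    have chain: "\<beta> ^ card A * card (Good (S - A)) \<le> card (Good S)" if "A \<subseteq> S" for A
    proof -
      have "finite A" using that less.prems finite_subset by auto
      then show ?thesis using that
      proof (induction A)
        case (insert a A)
        then have S: "S - A = insert a (S - insert a A)" by auto
        have "\<beta> * card (Good (S - insert a A)) \<le> card (Good (insert a (S - insert a A)))"
          using insert.prems less.prems by (intro less.hyps) (auto intro: psubset_card_mono)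
        then have "\<beta> ^ card A * (\<beta> * card (Good (S - insert a A))) \<le> \<beta> ^ card A * card (Good (S - A))"
          unfolding S[symmetric] using \<beta>0 by (intro mult_left_mono) auto
        with insert show ?case by (simp add: algebra_simps)
      qed simp
    qed
    define X where "X = {x \<in> insert v S \<rightarrow>\<^sub>E {..<q}. restrict x S \<in> Good S}"
    define J where "J = {i \<in> I. v \<in> e i \<and> e i \<subseteq> insert v S}"
    have finX: "finite X" unfolding X_def using less.prems by (auto intro!: finite_PiE)
    have finJ: "finite J" using finI by (simp add: J_def)
    have cardX: "card X = card (Good S) * q"
    proof -
      have "bij_betw (\<lambda>(x, c). x(v := c)) (Good S \<times> {..<q}) X"
      proof (rule bij_betw_byWitness[where f' = "\<lambda>x. (restrict x S, x v)"])
        have r: "restrict (x(v := c)) S = x" if "x \<in> Good S" for x c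
          using that less.prems(2) unfolding Good_def by (auto simp: fun_eq_iff PiE_iff extensional_def)
        show "\<forall>a\<in>Good S \<times> {..<q}. (\<lambda>x. (restrict x S, x v)) (case a of (x, c) \<Rightarrow> x(v := c)) = a"
          using r by auto
        show "(\<lambda>(x, c). x(v := c)) ` (Good S \<times> {..<q}) \<subseteq> X"
          using r unfolding X_def by (auto simp: Good_def PiE_iff extensional_def)
        show "\<forall>a'\<in>X. (case (restrict a' S, a' v) of (x, c) \<Rightarrow> x(v := c)) = a'"
          by (auto simp: X_def fun_eq_iff PiE_iff extensional_def)
        show "(\<lambda>x. (restrict x S, x v)) ` X \<subseteq> Good S \<times> {..<q}"
          by (auto simp: X_def PiE_iff)
      qed
      from bij_betw_same_card[OF this] show ?thesis by (simp add: card_cartesian_product)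
    qed
    have sub: "X - Good (insert v S) \<subseteq> (\<Union>i\<in>J. {x \<in> X. bad i x})"
    proof
      fix x assume x: "x \<in> X - Good (insert v S)"
      then obtain i where i: "i \<in> I" "e i \<subseteq> insert v S" "bad i x"
        unfolding X_def Good_def by auto
      have "v \<in> e i"
      proof (rule ccontr)
        assume "v \<notin> e i"
        then have "e i \<subseteq> S" using i by auto
        moreover have "bad i (restrict x S)"
          by (rule dep[OF i(1) _ i(3)]) (use \<open>e i \<subseteq> S\<close> in auto)
        ultimately show False using x i unfolding X_def Good_def by auto
      qed
      with i x show "x \<in> (\<Union>i\<in>J. {x \<in> X. bad i x})" unfolding J_def by auto
    qed
    have badcard: "card {x \<in> X. bad i x} \<le> q / (2 * N * M) * card (Good S)" if "i \<in> J" for i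
    proof -
      have i: "i \<in> I" "v \<in> e i" "e i \<subseteq> insert v S" using that by (auto simp: J_def)
      let ?P = "{x \<in> e i \<rightarrow>\<^sub>E {..<q}. bad i x}"
      have "finite ?P" using fin[OF i(1)] by (auto intro!: finite_PiE)
      have M0: "0 < M"
        using deg[of v] i finI by (auto simp: card_gt_0_iff intro!: Nat.gr0I)
      have "inj_on (\<lambda>x. (restrict x (S - e i), restrict x (e i))) {x \<in> X. bad i x}"
      proof (rule inj_onI)
        fix x y assume x: "x \<in> {x \<in> X. bad i x}" and y: "y \<in> {x \<in> X. bad i x}"
          and eq: "(restrict x (S - e i), restrict x (e i)) = (restrict y (S - e i), restrict y (e i))"
        have "x w = y w" if "w \<in> insert v S" for w
          using eq that i by (cases "w \<in> e i") (auto simp: restrict_eq_restrict_iff)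
        then show "x = y"
          by (rule PiE_ext[of x "insert v S" "\<lambda>_. {..<q}" y, rotated 2]) (use x y in \<open>auto simp: X_def\<close>)
      qed
      moreover have "(\<lambda>x. (restrict x (S - e i), restrict x (e i))) ` {x \<in> X. bad i x}
          \<subseteq> Good (S - e i) \<times> ?P"
      proof (rule image_subsetI)
        fix x assume x: "x \<in> {x \<in> X. bad i x}"
        then have "restrict (restrict x S) (S - e i) \<in> Good (S - e i)"
          unfolding X_def by (intro restr) auto
        moreover have "restrict (restrict x S) (S - e i) = restrict x (S - e i)"
          by (auto simp: fun_eq_iff)
        moreover have "bad i (restrict x (e i))"
          by (rule dep[OF i(1), of x]) (use x in auto)
        moreover have "restrict x (e i) \<in> e i \<rightarrow>\<^sub>E {..<q}"
          using x i unfolding X_def by (auto simp: PiE_iff)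
        ultimately show "(restrict x (S - e i), restrict x (e i)) \<in> Good (S - e i) \<times> ?P" by simp
      qed
      ultimately have "card {x \<in> X. bad i x} \<le> card (Good (S - e i) \<times> ?P)"
        using less.prems finGood \<open>finite ?P\<close> by (intro card_inj_on_le) auto
      then have c1: "real (card {x \<in> X. bad i x}) \<le> card (Good (S - e i)) * card ?P"
        by (simp add: card_cartesian_product flip: of_nat_mult)
      have SA: "S - e i = S - (S \<inter> e i)" by auto
      have "e i = insert v (S \<inter> e i)" using i by auto
      then have "card (e i) = Suc (card (S \<inter> e i))"
        by (metis Int_iff card_insert_disjoint finite_Int less.prems)
      then have cI: "card (S \<inter> e i) = N - 1" using N[OF i(1)] by simp
      have c2: "\<beta> ^ (N - 1) * card (Good (S - e i)) \<le> card (Good S)"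
        using chain[of "S \<inter> e i"] by (simp add: cI SA[symmetric])
      have "q ^ (N - 1) / 2 * card (Good (S - e i)) \<le> card (Good S)"
        using mult_right_mono[OF \<beta>pow, of "card (Good (S - e i))"] c2 by simp
      then have c3: "card (Good (S - e i)) \<le> 2 / q ^ (N - 1) * card (Good S)"
        using q by (simp add: field_simps)
      have "real (card ?P * (4 * N * M)) \<le> real (q ^ N)"
        using few[OF i(1)] by (simp only: of_nat_le_iff)
      then have c4: "card ?P \<le> q ^ N / (4 * N * M)"
        using \<open>0 < N\<close> M0 by (simp add: field_simps)
      have qN: "real q ^ N = real q * real q ^ (N - 1)" using \<open>0 < N\<close> by (simp flip: power_Suc)
      \<comment> \<open>The 2 lost through Bernoulli against \<open>4 * N * M\<close> in
        \<open>few\<close> leaves the fraction \<open>1 / (2 * N * M)\<close> for each edge. The at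
        most \<open>M\<close> edges at \<open>v\<close> together cost \<open>q / (2 * N)\<close>,
        which is exactly \<open>q - \<beta>\<close>.\<close>
      have "card {x \<in> X. bad i x} \<le> (2 / q ^ (N - 1) * card (Good S)) * (q ^ N / (4 * N * M))"
        using c1 mult_mono[OF c3 c4] q by auto
      also have "\<dots> = q / (2 * N * M) * card (Good S)"
      proof -
        have "(2 / Q * g) * (q * Q / (4 * n)) = q / (2 * n) * g" if "Q > 0" for Q g n :: real
          using that by (simp add: field_simps)
        from this[of "real (q ^ (N - 1))" "card (Good S)" "real N * M"] show ?thesis
          using q unfolding of_nat_power of_nat_mult of_nat_numeral qN mult.assoc by simp
      qed
      finally show ?thesis .
    qed
    have "card J \<le> card {i \<in> I. v \<in> e i}"
      using finI by (intro card_mono) (auto simp: J_def)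
    with deg[of v] have cJ: "card J \<le> M" by linarith
    have "real (card (X - Good (insert v S))) \<le> real (card (\<Union>i\<in>J. {x \<in> X. bad i x}))"
      using card_mono[OF _ sub] finX finJ by auto
    also have "\<dots> \<le> (\<Sum>i\<in>J. real (card {x \<in> X. bad i x}))"
      unfolding of_nat_sum[symmetric] of_nat_le_iff by (rule card_UN_le[OF finJ])
    also have "\<dots> \<le> card J * (q / (2 * N * M) * card (Good S))"
      by (intro sum_bounded_above badcard)
    also have "\<dots> \<le> M * (q / (2 * N * M) * card (Good S))"
      using cJ by (intro mult_right_mono) auto
    also have "\<dots> \<le> q / (2 * N) * card (Good S)"
      by (cases "M = 0") simp_all
    finally have b: "real (card (X - Good (insert v S))) \<le> q / (2 * N) * card (Good S)" .
    have "card X \<le> card (X - Good (insert v S)) + card (Good (insert v S))"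
    proof -
      have "card X \<le> card ((X - Good (insert v S)) \<union> Good (insert v S))"
        using finX finGood less.prems by (intro card_mono) auto
      then show ?thesis using card_Un_le order_trans by blast
    qed
    then have "real (card (Good S)) * q \<le> q / (2 * N) * card (Good S) + card (Good (insert v S))"
    proof -
      assume *: "card X \<le> card (X - Good (insert v S)) + card (Good (insert v S))"
      have "real (card X) \<le> real (card (X - Good (insert v S))) + real (card (Good (insert v S)))"
        using * by (metis of_nat_add of_nat_le_iff)
      then show ?thesis using b cardX by simp
    qed
    then show ?case by (simp add: \<beta>_def algebra_simps)
  qed
  define V where "V = (\<Union>i\<in>I. e i)"
  have "finite V" unfolding V_def using finI fin by auto
  then have "0 < card (Good V)"
  proof (induction V)
    case empty
    have "Good {} = {\<lambda>_. undefined}"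
      using N \<open>0 < N\<close> unfolding Good_def by fastforce
    then show ?case by simp
  next
    case (insert v V)
    then have "0 < \<beta> * card (Good V)" using \<beta>0 by simp
    with step[OF insert.hyps] show ?case by linarith
  qed
  then obtain x where x: "x \<in> Good V" by (metis card_gt_0_iff ex_in_conv)
  define y where "y v = (if v \<in> V then x v else 0)" for v
  have "y v < q" for v using x q unfolding Good_def y_def by (auto simp: PiE_iff)
  moreover have "\<not> bad i y" if i: "i \<in> I" for i
  proof
    assume "bad i y"
    then have "bad i x" by (rule dep[OF i, rotated]) (use i in \<open>auto simp: y_def V_def\<close>)
    then show False using x i unfolding Good_def V_def by auto
  qed
  ultimately show ?thesis by blast
qed

text \<open>Events on disjoint blocks are independent, so their probabilities multiply. In terms of
  counts, each block contributes at most \<open>c\<close> of its \<open>q ^ k\<close> colourings,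
  and the vertices outside the blocks are free.\<close>

lemma card_PiE_blocks_le:
  fixes A :: "'b \<Rightarrow> 'v set" and R :: "'b \<Rightarrow> ('v \<Rightarrow> nat) \<Rightarrow> bool" and q c :: nat
  assumes "finite B" "finite W" and "\<And>b. b \<in> B \<Longrightarrow> finite (A b)"
    and "disjoint_family_on A B" and "\<And>b. b \<in> B \<Longrightarrow> A b \<subseteq> W" "\<And>b. b \<in> B \<Longrightarrow> card (A b) = k"
    and "\<And>b x y. b \<in> B \<Longrightarrow> (\<And>v. v \<in> A b \<Longrightarrow> x v = y v) \<Longrightarrow> R b x \<Longrightarrow> R b y"
    and "\<And>b. b \<in> B \<Longrightarrow> card {x \<in> A b \<rightarrow>\<^sub>E {..<q}. R b x} \<le> c"
  shows "card {x \<in> W \<rightarrow>\<^sub>E {..<q}. \<forall>b\<in>B. R b x} \<le> c ^ card B * q ^ (card W - k * card B)"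
  using assms
proof (induction B arbitrary: W)
  case empty
  then show ?case by (simp add: card_PiE)
next
  case (insert b B)
  let ?L = "{x \<in> W \<rightarrow>\<^sub>E {..<q}. \<forall>b\<in>insert b B. R b x}"
  let ?W = "W - A b"
  let ?P = "{x \<in> A b \<rightarrow>\<^sub>E {..<q}. R b x}" and ?Q = "{x \<in> ?W \<rightarrow>\<^sub>E {..<q}. \<forall>b\<in>B. R b x}"
  have sub: "A c \<subseteq> ?W" if "c \<in> B" for c
    using insert.prems(3,4) that insert.hyps by (fastforce simp: disjoint_family_on_def)
  have "inj_on (\<lambda>x. (restrict x (A b), restrict x ?W)) ?L"
  proof (rule inj_onI)
    fix x y assume x: "x \<in> ?L" and y: "y \<in> ?L"
      and eq: "(restrict x (A b), restrict x ?W) = (restrict y (A b), restrict y ?W)"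
    have "x w = y w" if "w \<in> W" for w
      using eq that by (cases "w \<in> A b") (auto simp: restrict_eq_restrict_iff)
    then show "x = y"
      by (rule PiE_ext[of x W "\<lambda>_. {..<q}" y, rotated 2]) (use x y in auto)
  qed
  moreover have "(\<lambda>x. (restrict x (A b), restrict x ?W)) ` ?L \<subseteq> ?P \<times> ?Q"
  proof (rule image_subsetI)
    fix x assume x: "x \<in> ?L"
    have "R b (restrict x (A b))"
      by (rule insert.prems(6)[of b x]) (use x in auto)
    moreover have "R c (restrict x ?W)" if "c \<in> B" for c
      by (rule insert.prems(6)[of c x]) (use x sub[OF that] that in auto)
    ultimately show "(restrict x (A b), restrict x ?W) \<in> ?P \<times> ?Q"
      using x insert.prems(4)[of b] by (auto simp: PiE_iff)
  qed
  moreover have "finite (?P \<times> ?Q)"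
    by (intro finite_cartesian_product finite_Collect_conjI disjI1)
      (use insert.prems in \<open>simp_all add: finite_PiE\<close>)
  ultimately have "card ?L \<le> card (?P \<times> ?Q)" by (rule card_inj_on_le)
  also have "\<dots> = card ?P * card ?Q" by (rule card_cartesian_product)
  also have "\<dots> \<le> c * (c ^ card B * q ^ (card ?W - k * card B))"
  proof (rule mult_le_mono)
    show "card ?P \<le> c" using insert.prems by simp
    show "card ?Q \<le> c ^ card B * q ^ (card ?W - k * card B)"
    proof (rule insert.IH)
      show "disjoint_family_on A B"
        using insert.prems(3) by (auto simp: disjoint_family_on_def)
      show "R c y" if "c \<in> B" "\<And>v. v \<in> A c \<Longrightarrow> x v = y v" "R c x" for c x y
        using insert.prems(6)[of c x y] that by blast
    qed (use insert.prems sub in simp_all)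
  qed
  also have "card ?W - k * card B = card W - k * card (insert b B)"
    using insert.prems insert.hyps by (simp add: card_Diff_subset)
  finally show ?case using insert.hyps by (simp add: mult.assoc)
qed

section \<open>Sparse hitting sets in groups\<close>

text \<open>In the local lemma below, edge size times degree grows like \<open>m ^ 2\<close>, while
  the probability of a bad event decays geometrically.\<close>

lemma eventually_square_times_powers_le:
  fixes \<rho> C :: real
  assumes "0 \<le> \<rho>" "\<rho> < 1"
  shows "\<forall>\<^sub>F m in sequentially. C * real m ^ 2 * (\<rho> ^ (2 * m) + (1/2) ^ m) \<le> 1"
proof -
  have lim: "(\<lambda>m. real m ^ 2 * r ^ m) \<longlonglongrightarrow> 0" if "0 \<le> r" "r < 1" for r :: real
  proof -
    have "(\<lambda>m. (real m * sqrt r ^ m) ^ 2) \<longlonglongrightarrow> 0 ^ 2"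
      using that by (intro tendsto_power powser_times_n_limit_0) auto
    moreover have "(real m * sqrt r ^ m) ^ 2 = real m ^ 2 * r ^ m" for m
      using that by (simp add: power_mult_distrib flip: power_mult)
        (simp add: mult.commute[of m 2] power_mult)
    ultimately show ?thesis by simp
  qed
  have "\<rho> ^ 2 < 1" using assms by (simp add: power_less_one_iff)
  then have "(\<lambda>m. C * (real m ^ 2 * (\<rho> ^ 2) ^ m + real m ^ 2 * (1/2) ^ m)) \<longlonglongrightarrow> C * (0 + 0)"
    using assms by (intro tendsto_intros lim) auto
  then have "\<forall>\<^sub>F m in sequentially. C * (real m ^ 2 * (\<rho> ^ 2) ^ m + real m ^ 2 * (1/2) ^ m) < 1"
    by (auto dest!: order_tendstoD(2)[of _ _ _ 1])
  then show ?thesis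
    by eventually_elim (simp add: algebra_simps flip: power_mult)
qed

lemma card_PiE_zero_at:
  assumes "finite A" "v \<in> A" "0 < q"
  shows "card {x \<in> A \<rightarrow>\<^sub>E {..<q::nat}. x v = 0} = q ^ (card A - 1)"
proof -
  have "{x \<in> A \<rightarrow>\<^sub>E {..<q}. x v = 0} = (\<Pi>\<^sub>E w\<in>A. if w = v then {0} else {..<q})"
  proof (rule Set.set_eqI)
    fix x
    have "(\<forall>i\<in>A. x i \<in> (if i = v then {0} else {..<q})) \<longleftrightarrow> (\<forall>i\<in>A. x i \<in> {..<q}) \<and> x v = 0"
      using assms by (metis insert_iff empty_iff lessThan_iff)
    then show "x \<in> {x \<in> A \<rightarrow>\<^sub>E {..<q}. x v = 0} \<longleftrightarrow> x \<in> (\<Pi>\<^sub>E w\<in>A. if w = v then {0} else {..<q})"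
      unfolding PiE_iff by blast
  qed
  then have "card {x \<in> A \<rightarrow>\<^sub>E {..<q}. x v = 0} = (\<Prod>w\<in>A. card (if w = v then {0} else {..<q}))"
    using assms by (simp add: card_PiE)
  also have "\<dots> = (\<Prod>w\<in>A - {v}. q)"
    using assms by (subst prod.remove[of _ v]) (auto intro!: prod.cong)
  finally show ?thesis using assms by simp
qed

text \<open>With the whole type as carrier, membership conditions disappear. The general case
  returns through an isomorphic copy on \<open>nat\<close>.\<close>

locale full_group = group G for G (structure) +
  assumes carrier_UNIV [simp]: "carrier G = UNIV"
begin

lemma inv_cancel [simp]: "inv x \<otimes> (x \<otimes> y) = y" "x \<otimes> (inv x \<otimes> y) = y"
  by (simp_all flip: m_assoc)

lemma l_cancel [simp]: "x \<otimes> y = x \<otimes> z \<longleftrightarrow> y = z"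
  by (metis inv_cancel(1))

text \<open>Colour 0 marks the selected points of a random colouring. By \<open>disj\<close> the
  blocks around the points \<open>h \<otimes> b\<close> are disjoint for different \<open>b\<close>,
  hence independent. That \<open>2 * m\<close> blocks all lack an isolated zero at the centre has
  probability at most the first power in \<open>num\<close>; that more than \<open>m\<close> blocks
  contain a zero, at most the second.\<close>

lemma isolated_zeros_colouring:
  fixes B H :: "'a set" and Bh :: "'a \<Rightarrow> 'a set" and m k q :: nat
  assumes finE: "finite E" and one: "\<one> \<in> E" and k: "k = card E" and q: "q = 128 * k" and m: "0 < m"
    and num: "4 * (6 * m * k)^2 * ((1 - 1 / real (q ^ k)) ^ (2 * m) + (1/2) ^ m) \<le> (1::real)"
    and finB: "finite B" and cardB: "card B = 6 * m"
    and disj: "\<And>b b' e e'. b \<in> B \<Longrightarrow> b' \<in> B \<Longrightarrow> e \<in> E \<Longrightarrow> e' \<in> E \<Longrightarrow> b \<otimes> e = b' \<otimes> e' \<Longrightarrow> b = b'"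
    and finH: "finite H" "finite I" and Bh: "\<And>h. h \<in> H \<Longrightarrow> Bh h \<subseteq> B \<and> 2 * m \<le> card (Bh h)"
  shows "\<exists>x :: 'a \<Rightarrow> nat.
      (\<forall>h\<in>H. \<exists>b\<in>Bh h. x (h \<otimes> b) = 0 \<and> (\<forall>e\<in>E. e \<noteq> \<one> \<longrightarrow> x (h \<otimes> b \<otimes> e) \<noteq> 0)) \<and>
      (\<forall>h\<in>I. card {b \<in> B. \<exists>e\<in>E. x (h \<otimes> b \<otimes> e) = 0} \<le> m)"
proof -
  define A where "A h b = (\<lambda>e. h \<otimes> b \<otimes> e) ` E" for h b
  define W where "W h = (\<Union>b\<in>B. A h b)" for h
  define special where "special h b x \<longleftrightarrow> x (h \<otimes> b) = (0::nat) \<and> (\<forall>e\<in>E. e \<noteq> \<one> \<longrightarrow> x (h \<otimes> b \<otimes> e) \<noteq> 0)"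
    for h b x
  define bad where "bad h x \<longleftrightarrow> h \<in> H \<and> (\<forall>b\<in>Bh h. \<not> special h b x) \<or>
      m < card {b \<in> B. \<exists>e\<in>E. x (h \<otimes> b \<otimes> e) = 0}" for h and x :: "'a \<Rightarrow> nat"
  let ?N = "6 * m * k"
  have k0: "0 < k" using finE one k card_gt_0_iff by blast
  have q1: "1 < q" using q k0 by simp
  have finA: "finite (A h b)" for h b using finE by (simp add: A_def)
  have cardA: "card (A h b) = k" for h b
  proof -
    have "inj_on (\<lambda>e. h \<otimes> b \<otimes> e) E" by (intro inj_onI) simp
    then show ?thesis unfolding A_def k by (rule card_image)
  qed
  have disjA: "disjoint_family_on (A h) B" for h
  proof -
    have "b = b'" if b: "b \<in> B" "b' \<in> B" "v \<in> A h b" "v \<in> A h b'" for b b' v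
    proof -
      obtain e e' where e: "e \<in> E" "e' \<in> E" "h \<otimes> b \<otimes> e = h \<otimes> b' \<otimes> e'"
        using b(3,4) unfolding A_def by blast
      then have "b \<otimes> e = b' \<otimes> e'" by (simp add: m_assoc)
      with disj b(1,2) e(1,2) show ?thesis by blast
    qed
    then show ?thesis unfolding disjoint_family_on_def by blast
  qed
  have finW: "finite (W h)" for h using finA finB by (simp add: W_def)
  have finP: "finite {x \<in> W h \<rightarrow>\<^sub>E {..<q}. P x}" for h P
    by (rule finite_subset[of _ "W h \<rightarrow>\<^sub>E {..<q}"]) (auto intro!: finite_PiE finW)
  have cardW: "card (W h) = ?N" for h
    unfolding W_def using finB finA disjA cardA
    by (subst card_UN_disjoint') (auto simp: cardB)
  have special_cong: "special h b x = special h b y" if "\<And>v. v \<in> A h b \<Longrightarrow> x v = y v" for h b x y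
  proof -
    have "x (h \<otimes> b \<otimes> e) = y (h \<otimes> b \<otimes> e)" if "e \<in> E" for e
      using that \<open>\<And>v. v \<in> A h b \<Longrightarrow> x v = y v\<close> by (auto simp: A_def)
    moreover from this[OF one] have "x (h \<otimes> b) = y (h \<otimes> b)" by simp
    ultimately show ?thesis unfolding special_def by auto
  qed
  have zero_cong: "(\<exists>e\<in>E. x (h \<otimes> b \<otimes> e) = 0) = (\<exists>e\<in>E. y (h \<otimes> b \<otimes> e) = (0::nat))"
    if "\<And>v. v \<in> A h b \<Longrightarrow> x v = y v" for h b x y
    using that by (auto simp: A_def)
  have nonspecial: "card {x \<in> A h b \<rightarrow>\<^sub>E {..<q}. \<not> special h b x} \<le> q ^ k - 1" for h b
  proof -
    \<comment> \<open>One favourable colouring is enough: 0 at the centre and 1 elsewhere. It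
      accounts for the 1 subtracted from \<open>q ^ k\<close>.\<close>
    define z where "z = restrict (\<lambda>v. if v = h \<otimes> b then 0 else 1::nat) (A h b)"
    have hb: "h \<otimes> b \<in> A h b" using one unfolding A_def by (intro image_eqI[where x = \<one>]) auto
    have z: "z \<in> A h b \<rightarrow>\<^sub>E {..<q}" "special h b z"
      using q1 hb by (auto simp: z_def special_def A_def m_assoc)
    have "card {x \<in> A h b \<rightarrow>\<^sub>E {..<q}. \<not> special h b x} \<le> card ((A h b \<rightarrow>\<^sub>E {..<q}) - {z})"
      using z finA by (intro card_mono) (auto intro!: finite_PiE)
    also have "\<dots> = q ^ k - 1"
      using z finA by (simp add: card_PiE cardA)
    finally show ?thesis .
  qed
  have withzero: "card {x \<in> A h b \<rightarrow>\<^sub>E {..<q}. \<exists>e\<in>E. x (h \<otimes> b \<otimes> e) = 0} \<le> k * q ^ (k - 1)" for h b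
  proof -
    have "{x \<in> A h b \<rightarrow>\<^sub>E {..<q}. \<exists>e\<in>E. x (h \<otimes> b \<otimes> e) = 0}
        = (\<Union>v\<in>A h b. {x \<in> A h b \<rightarrow>\<^sub>E {..<q}. x v = 0})"
      by (auto simp: A_def)
    also have "card \<dots> \<le> (\<Sum>v\<in>A h b. card {x \<in> A h b \<rightarrow>\<^sub>E {..<q}. x v = 0})"
      by (rule card_UN_le[OF finA])
    also have "\<dots> = k * q ^ (k - 1)"
      using q1 by (simp add: card_PiE_zero_at finA cardA)
    finally show ?thesis .
  qed
  have qN: "real q ^ ?N = real q ^ (k * j) * real q ^ (?N - k * j)" if "j \<le> 6 * m" for j
    using that by (simp flip: power_add)
  have count1: "card {x \<in> W h \<rightarrow>\<^sub>E {..<q}. h \<in> H \<and> (\<forall>b\<in>Bh h. \<not> special h b x)}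
      \<le> q ^ ?N * (1 - 1 / real (q ^ k)) ^ (2 * m)" (is "real (card ?S) \<le> _") for h
  proof (cases "h \<in> H")
    case True
    then obtain C where C: "C \<subseteq> Bh h" "card C = 2 * m" "finite C"
      using Bh obtain_subset_with_card_n by metis
    have CB: "C \<subseteq> B" using C Bh True by auto
    have "card ?S \<le> card {x \<in> W h \<rightarrow>\<^sub>E {..<q}. \<forall>b\<in>C. \<not> special h b x}"
      using C by (intro card_mono finP) auto
    also have "\<dots> \<le> (q ^ k - 1) ^ card C * q ^ (card (W h) - k * card C)"
    proof (rule card_PiE_blocks_le[where A = "A h"])
      show "disjoint_family_on (A h) C" using disjA CB by (auto simp: disjoint_family_on_def)
      show "\<not> special h b y" if "\<And>v. v \<in> A h b \<Longrightarrow> x v = y v" "\<not> special h b x" for b x y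
        using special_cong[of h b x y] that by blast
    qed (use C CB finA finW cardA nonspecial in \<open>auto simp: W_def\<close>)
    finally have "card ?S \<le> (q ^ k - 1) ^ (2 * m) * q ^ (?N - k * (2 * m))"
      by (simp only: C(2) cardW)
    then have "real (card ?S) \<le> real (q ^ k - 1) ^ (2 * m) * real q ^ (?N - k * (2 * m))"
      by (simp only: of_nat_le_iff flip: of_nat_mult of_nat_power)
    also have "real (q ^ k - 1) = real q ^ k * (1 - 1 / real (q ^ k))"
      using q1 by (simp add: of_nat_diff algebra_simps)
    also have "\<dots> ^ (2 * m) * real q ^ (?N - k * (2 * m)) = q ^ ?N * (1 - 1 / real (q ^ k)) ^ (2 * m)"
      using qN[of "2 * m"] by (simp add: power_mult_distrib power_mult)
    finally show ?thesis .
  qed (use q1 in auto)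
  have count2: "card {x \<in> W h \<rightarrow>\<^sub>E {..<q}. m < card {b \<in> B. \<exists>e\<in>E. x (h \<otimes> b \<otimes> e) = 0}}
      \<le> q ^ ?N * (1/2) ^ m" (is "real (card ?S) \<le> _") for h
  proof -
    let ?Cs = "{C. C \<subseteq> B \<and> card C = m}"
    let ?Z = "\<lambda>C. {x \<in> W h \<rightarrow>\<^sub>E {..<q}. \<forall>b\<in>C. \<exists>e\<in>E. x (h \<otimes> b \<otimes> e) = 0}"
    have finCs: "finite ?Cs" using finB by auto
    have "?S \<subseteq> (\<Union>C\<in>?Cs. ?Z C)"
    proof
      fix x assume x: "x \<in> ?S"
      then obtain C where "C \<subseteq> {b \<in> B. \<exists>e\<in>E. x (h \<otimes> b \<otimes> e) = 0}" "card C = m"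
        using obtain_subset_with_card_n[of m] by (auto dest!: less_imp_le)
      with x show "x \<in> (\<Union>C\<in>?Cs. ?Z C)" by blast
    qed
    then have "card ?S \<le> card (\<Union>C\<in>?Cs. ?Z C)"
      using finCs by (intro card_mono finite_UN_I finP)
    also have "\<dots> \<le> (\<Sum>C\<in>?Cs. card (?Z C))" by (rule card_UN_le[OF finCs])
    also have "\<dots> \<le> (\<Sum>C\<in>?Cs. (k * q ^ (k - 1)) ^ m * q ^ (?N - k * m))"
    proof (rule sum_mono)
      fix C assume C: "C \<in> ?Cs"
      have "card (?Z C) \<le> (k * q ^ (k - 1)) ^ card C * q ^ (card (W h) - k * card C)"
      proof (rule card_PiE_blocks_le[where A = "A h"])
        show "disjoint_family_on (A h) C" using disjA C by (auto simp: disjoint_family_on_def)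
        show "\<exists>e\<in>E. y (h \<otimes> b \<otimes> e) = 0"
          if "\<And>v. v \<in> A h b \<Longrightarrow> x v = y v" "\<exists>e\<in>E. x (h \<otimes> b \<otimes> e) = 0" for b and x y :: "'a \<Rightarrow> nat"
          using zero_cong[of h b x y] that by blast
      qed (use C finB finA finW cardA withzero in \<open>auto simp: W_def intro: finite_subset\<close>)
      then show "card (?Z C) \<le> (k * q ^ (k - 1)) ^ m * q ^ (?N - k * m)"
        using C by (simp add: cardW)
    qed
    also have "\<dots> = (6 * m choose m) * ((k * q ^ (k - 1)) ^ m * q ^ (?N - k * m))"
      using n_subsets[OF finB, of m] by (simp add: cardB)
    also have "\<dots> \<le> 2 ^ (6 * m) * ((k * q ^ (k - 1)) ^ m * q ^ (?N - k * m))"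
      by (intro mult_right_mono binomial_le_pow2) simp
    \<comment> \<open>The choice of \<open>m\<close> blocks costs a factor of at most
      \<open>64 ^ m\<close>, and each block contains a zero with probability at most
      \<open>k / q\<close>. With \<open>q = 128 * k\<close> the product is
      \<open>(64 / 128) ^ m\<close>.\<close>
    also have "2 ^ (6 * m) = (64::nat) ^ m" by (simp add: power_mult)
    finally have "real (card ?S) \<le> real (64 ^ m * ((k * q ^ (k - 1)) ^ m * q ^ (?N - k * m)))"
      by (simp only: of_nat_le_iff)
    then have "real (card ?S) \<le> 64 ^ m * ((k * real q ^ (k - 1)) ^ m * real q ^ (?N - k * m))"
      by (simp only: of_nat_mult of_nat_power of_nat_numeral)
    also have "\<dots> = (64 * (k * real q ^ (k - 1))) ^ m * real q ^ (?N - k * m)"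
      by (simp add: power_mult_distrib)
    also have "64 * (k * real q ^ (k - 1)) = real q ^ k * (1/2)"
    proof -
      have "real q ^ k = q * real q ^ (k - 1)" using k0 by (simp flip: power_Suc)
      then show ?thesis using q by simp
    qed
    also have "\<dots> ^ m * real q ^ (?N - k * m) = q ^ ?N * (1/2) ^ m"
      using qN[of m] unfolding of_nat_power power_mult_distrib power_mult[of "real q" k m] by simp
    finally show ?thesis .
  qed
  have "\<exists>x. (\<forall>v. x v < q) \<and> (\<forall>h\<in>H \<union> I. \<not> bad h x)"
  proof (rule local_lemma_counting[where e = W and N = ?N and M = ?N])
    \<comment> \<open>If \<open>v = h \<otimes> b \<otimes> e\<close>, then \<open>h\<close> is
      determined by \<open>v\<close>, \<open>b\<close> and \<open>e\<close>. So the degree has the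
      same bound as the edge size, whence the square in \<open>num\<close>.\<close>
    show "card {i \<in> H \<union> I. v \<in> W i} \<le> ?N" for v
    proof -
      have "{i \<in> H \<union> I. v \<in> W i} \<subseteq> (\<lambda>(b, e). v \<otimes> inv e \<otimes> inv b) ` (B \<times> E)"
        by (force simp: W_def A_def m_assoc)
      then have "card {i \<in> H \<union> I. v \<in> W i} \<le> card (B \<times> E)"
        using finB finE by (intro surj_card_le) auto
      then show ?thesis by (simp add: card_cartesian_product cardB k)
    qed
    show "bad h y" if xy: "\<And>v. v \<in> W h \<Longrightarrow> x v = y v" and "bad h x" for h x y
    proof -
      have s: "special h b x = special h b y" if "b \<in> B" for b
        by (rule special_cong[OF xy]) (use that in \<open>auto simp: W_def\<close>)
      have z: "(\<exists>e\<in>E. x (h \<otimes> b \<otimes> e) = 0) = (\<exists>e\<in>E. y (h \<otimes> b \<otimes> e) = 0)" if "b \<in> B" for b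
        by (rule zero_cong[OF xy]) (use that in \<open>auto simp: W_def\<close>)
      have z': "{b \<in> B. \<exists>e\<in>E. x (h \<otimes> b \<otimes> e) = 0} = {b \<in> B. \<exists>e\<in>E. y (h \<otimes> b \<otimes> e) = 0}"
        using z by blast
      show ?thesis using \<open>bad h x\<close> Bh s unfolding bad_def z' by blast
    qed
    show "card {x \<in> W h \<rightarrow>\<^sub>E {..<q}. bad h x} * (4 * ?N * ?N) \<le> q ^ ?N" for h
    proof -
      have "{x \<in> W h \<rightarrow>\<^sub>E {..<q}. bad h x} =
          {x \<in> W h \<rightarrow>\<^sub>E {..<q}. h \<in> H \<and> (\<forall>b\<in>Bh h. \<not> special h b x)} \<union>
          {x \<in> W h \<rightarrow>\<^sub>E {..<q}. m < card {b \<in> B. \<exists>e\<in>E. x (h \<otimes> b \<otimes> e) = 0}}"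
        unfolding bad_def by auto
      then have "card {x \<in> W h \<rightarrow>\<^sub>E {..<q}. bad h x} \<le>
          card {x \<in> W h \<rightarrow>\<^sub>E {..<q}. h \<in> H \<and> (\<forall>b\<in>Bh h. \<not> special h b x)} +
          card {x \<in> W h \<rightarrow>\<^sub>E {..<q}. m < card {b \<in> B. \<exists>e\<in>E. x (h \<otimes> b \<otimes> e) = 0}}"
        by (simp add: card_Un_le)
      then have "real (card {x \<in> W h \<rightarrow>\<^sub>E {..<q}. bad h x}) \<le>
          q ^ ?N * (1 - 1 / real (q ^ k)) ^ (2 * m) + q ^ ?N * (1/2) ^ m"
        using count1[of h] count2[of h] by linarith
      then have "real (card {x \<in> W h \<rightarrow>\<^sub>E {..<q}. bad h x}) * (4 * (6 * m * k)^2) \<le>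
          (q ^ ?N * ((1 - 1 / real (q ^ k)) ^ (2 * m) + (1/2) ^ m)) * (4 * (6 * m * k)^2)"
        by (intro mult_right_mono) (simp_all add: algebra_simps)
      also have "\<dots> = q ^ ?N * (4 * (6 * m * k)^2 * ((1 - 1 / real (q ^ k)) ^ (2 * m) + (1/2) ^ m))"
        by (simp only: mult_ac)
      also have "\<dots> \<le> real (q ^ ?N) * 1"
        using num by (intro mult_left_mono) simp_all
      finally have "real (card {x \<in> W h \<rightarrow>\<^sub>E {..<q}. bad h x} * (4 * ?N * ?N)) \<le> real (q ^ ?N)"
        by (simp add: power2_eq_square mult_ac)
      then show ?thesis by (simp only: of_nat_le_iff)
    qed
  qed (use finH finW cardW q1 m k0 in auto)
  then obtain x where x: "\<And>h. h \<in> H \<union> I \<Longrightarrow> \<not> bad h x" by blast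
  show ?thesis
  proof (intro exI[of _ x] conjI ballI)
    show "\<exists>b\<in>Bh h. x (h \<otimes> b) = 0 \<and> (\<forall>e\<in>E. e \<noteq> \<one> \<longrightarrow> x (h \<otimes> b \<otimes> e) \<noteq> 0)" if "h \<in> H" for h
      using x[of h] that unfolding bad_def special_def by blast
    show "card {b \<in> B. \<exists>e\<in>E. x (h \<otimes> b \<otimes> e) = 0} \<le> m" if "h \<in> I" for h
      using x[of h] that unfolding bad_def by (simp add: not_less)
  qed
qed

text \<open>The order of quantifiers matters: \<open>m\<close> depends on \<open>E\<close> alone, so
  that \<open>B\<close> can be made generic of size \<open>6 * m\<close> afterwards, and
  \<open>H\<close> and the free places \<open>Bh\<close> can vary with every extension problem. The
  last bound ranges over all \<open>h\<close>, since the selected points must not crowd translates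
  outside \<open>H\<close> either.\<close>

lemma sparse_hitting_set:
  assumes finE: "finite E" and one: "\<one> \<in> E"
  shows "\<exists>m>0. \<forall>B H Bh. finite B \<and> card B = 6 * m \<and>
      (\<forall>b\<in>B. \<forall>b'\<in>B. \<forall>e\<in>E. \<forall>e'\<in>E. b \<otimes> e = b' \<otimes> e' \<longrightarrow> b = b') \<and>
      finite H \<and> (\<forall>h\<in>H. Bh h \<subseteq> B \<and> 2 * m \<le> card (Bh h)) \<longrightarrow>
      (\<exists>L. L \<subseteq> {h \<otimes> b | h b. h \<in> H \<and> b \<in> Bh h} \<and> (\<forall>l\<in>L. \<forall>l'\<in>L. l \<noteq> l' \<longrightarrow> inv l \<otimes> l' \<notin> E) \<and>
        (\<forall>h\<in>H. \<exists>b\<in>Bh h. h \<otimes> b \<in> L) \<and> (\<forall>h. card {b \<in> B. \<exists>l\<in>L. inv (h \<otimes> b) \<otimes> l \<in> E} \<le> m))"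
proof -
  define k where "k = card E"
  define q where "q = 128 * k"
  have k0: "0 < k" using finE one k_def card_gt_0_iff by blast
  then have "0 < q ^ k" by (simp add: q_def)
  then have Q: "0 \<le> 1 - 1 / real (q ^ k)" "1 - 1 / real (q ^ k) < 1"
    by (simp_all add: Suc_le_eq del: of_nat_power)
  \<comment> \<open>Here 144 is \<open>4 * 6 ^ 2\<close>, from
    \<open>4 * (6 * m * k)^2\<close>.\<close>
  have "\<forall>\<^sub>F m in sequentially.
      (144 * real k ^ 2) * real m ^ 2 * ((1 - 1 / real (q ^ k)) ^ (2 * m) + (1/2) ^ m) \<le> 1"
    using Q by (intro eventually_square_times_powers_le)
  then obtain m\<^sub>0 where m0: "\<And>m. m\<^sub>0 \<le> m \<Longrightarrow>
      (144 * real k ^ 2) * real m ^ 2 * ((1 - 1 / real (q ^ k)) ^ (2 * m) + (1/2) ^ m) \<le> 1"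
    by (auto simp: eventually_sequentially)
  define m where "m = Suc m\<^sub>0"
  then have m: "Suc m\<^sub>0 \<le> m" by simp
  show ?thesis
  proof (intro exI[of _ m] conjI allI impI; (elim conjE)?)
    show "0 < m" by (simp add: m_def)
    fix B H and Bh :: "'a \<Rightarrow> 'a set"
    assume finB: "finite B" and cardB: "card B = 6 * m"
      and "\<forall>b\<in>B. \<forall>b'\<in>B. \<forall>e\<in>E. \<forall>e'\<in>E. b \<otimes> e = b' \<otimes> e' \<longrightarrow> b = b'"
      and finH: "finite H" and "\<forall>h\<in>H. Bh h \<subseteq> B \<and> 2 * m \<le> card (Bh h)"
    then have disj: "\<And>b b' e e'. b \<in> B \<Longrightarrow> b' \<in> B \<Longrightarrow> e \<in> E \<Longrightarrow> e' \<in> E \<Longrightarrow> b \<otimes> e = b' \<otimes> e' \<Longrightarrow> b = b'"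
      and Bh: "\<And>h. h \<in> H \<Longrightarrow> Bh h \<subseteq> B \<and> 2 * m \<le> card (Bh h)"
      by blast+
    define P where "P = {h \<otimes> b | h b. h \<in> H \<and> b \<in> Bh h}"
    have "P \<subseteq> (\<lambda>(h, b). h \<otimes> b) ` (H \<times> B)" using Bh by (force simp: P_def)
    then have finP: "finite P" using finH finB by (auto intro: finite_subset)
    \<comment> \<open>The local lemma needs finitely many edges. For \<open>h\<close> outside this
      set no block of \<open>h\<close> meets the candidates \<open>P\<close>, so there is nothing to
      count.\<close>
    define I where "I = (\<lambda>(l, e, b). l \<otimes> inv e \<otimes> inv b) ` (P \<times> E \<times> B)"
    have finI: "finite I" using finP finE finB by (simp add: I_def)
    have "4 * (6 * m * k)^2 * ((1 - 1 / real (q ^ k)) ^ (2 * m) + (1/2) ^ m) \<le> (1::real)"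
      using m0[of m] m by (simp add: power_mult_distrib mult_ac)
    moreover have "0 < m" using m by simp
    ultimately have "\<exists>x :: 'a \<Rightarrow> nat.
      (\<forall>h\<in>H. \<exists>b\<in>Bh h. x (h \<otimes> b) = 0 \<and> (\<forall>e\<in>E. e \<noteq> \<one> \<longrightarrow> x (h \<otimes> b \<otimes> e) \<noteq> 0)) \<and>
      (\<forall>h\<in>I. card {b \<in> B. \<exists>e\<in>E. x (h \<otimes> b \<otimes> e) = 0} \<le> m)"
      by (intro isolated_zeros_colouring[OF finE one k_def q_def _ _ finB cardB disj finH finI Bh])
    then obtain x :: "'a \<Rightarrow> nat" where
      x1: "\<And>h. h \<in> H \<Longrightarrow> \<exists>b\<in>Bh h. x (h \<otimes> b) = 0 \<and> (\<forall>e\<in>E. e \<noteq> \<one> \<longrightarrow> x (h \<otimes> b \<otimes> e) \<noteq> 0)"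
      and x2: "\<And>h. h \<in> I \<Longrightarrow> card {b \<in> B. \<exists>e\<in>E. x (h \<otimes> b \<otimes> e) = 0} \<le> m"
      by blast
    \<comment> \<open>Only isolated zeros are kept: two of them differing by an element of
      \<open>E\<close> would contradict isolation.\<close>
    define L where "L = {l \<in> P. x l = 0 \<and> (\<forall>e\<in>E. e \<noteq> \<one> \<longrightarrow> x (l \<otimes> e) \<noteq> 0)}"
    have "inv l \<otimes> l' \<notin> E" if "l \<in> L" "l' \<in> L" "l \<noteq> l'" for l l'
    proof
      assume "inv l \<otimes> l' \<in> E"
      moreover have "inv l \<otimes> l' \<noteq> \<one>" using that by (metis UNIV_I carrier_UNIV inv_cancel(2) r_one)
      ultimately have "x (l \<otimes> (inv l \<otimes> l')) \<noteq> 0" using that unfolding L_def by blast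
      then show False using that by (simp add: L_def)
    qed
    moreover have "\<exists>b\<in>Bh h. h \<otimes> b \<in> L" if "h \<in> H" for h
      using x1[OF that] that unfolding L_def P_def by blast
    moreover have "card {b \<in> B. \<exists>l\<in>L. inv (h \<otimes> b) \<otimes> l \<in> E} \<le> m" for h
    proof (cases "h \<in> I")
      case True
      have "{b \<in> B. \<exists>l\<in>L. inv (h \<otimes> b) \<otimes> l \<in> E} \<subseteq> {b \<in> B. \<exists>e\<in>E. x (h \<otimes> b \<otimes> e) = 0}"
      proof clarify
        fix b l assume "b \<in> B" "l \<in> L" "inv (h \<otimes> b) \<otimes> l \<in> E"
        then show "\<exists>e\<in>E. x (h \<otimes> b \<otimes> e) = 0"
          by (intro bexI[of _ "inv (h \<otimes> b) \<otimes> l"]) (auto simp: L_def)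
      qed
      then have "card {b \<in> B. \<exists>l\<in>L. inv (h \<otimes> b) \<otimes> l \<in> E} \<le> card {b \<in> B. \<exists>e\<in>E. x (h \<otimes> b \<otimes> e) = 0}"
        using finB by (intro card_mono) auto
      with x2[OF True] show ?thesis by simp
    next
      case False
      have "{b \<in> B. \<exists>l\<in>L. inv (h \<otimes> b) \<otimes> l \<in> E} = {}"
      proof -
        have False if "b \<in> B" "l \<in> L" "inv (h \<otimes> b) \<otimes> l \<in> E" for b l
        proof -
          have "h = l \<otimes> inv (inv (h \<otimes> b) \<otimes> l) \<otimes> inv b"
            by (simp add: inv_mult_group m_assoc)
          then have "h \<in> I"
            unfolding I_def using that by (intro image_eqI[where x = "(l, inv (h \<otimes> b) \<otimes> l, b)"]) (auto simp: L_def)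
          with \<open>h \<notin> I\<close> show False by simp
        qed
        then show ?thesis by blast
      qed
      then show ?thesis by (metis card.empty le0)
    qed
    ultimately show "\<exists>L. L \<subseteq> {h \<otimes> b | h b. h \<in> H \<and> b \<in> Bh h} \<and>
        (\<forall>l\<in>L. \<forall>l'\<in>L. l \<noteq> l' \<longrightarrow> inv l \<otimes> l' \<notin> E) \<and> (\<forall>h\<in>H. \<exists>b\<in>Bh h. h \<otimes> b \<in> L) \<and>
        (\<forall>h. card {b \<in> B. \<exists>l\<in>L. inv (h \<otimes> b) \<otimes> l \<in> E} \<le> m)"
      unfolding P_def[symmetric] by (intro exI[of _ L]) (auto simp: L_def)
  qed
qed

end

section \<open>Generic sets in icc groups\<close>

locale full_icc_group = full_group +
  assumes icc: "g \<noteq> \<one> \<Longrightarrow> infinite {inv h \<otimes> g \<otimes> h | h. True}"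
    and nontrivial: "\<exists>g. g \<noteq> \<one>"
begin

text \<open>B. H. Neumann's covering argument: a coset of the centralizer \<open>C(x)\<close> missed by \<open>C(x)Z\<close> is covered by
  cosets of the other centralizers, hence so is \<open>C(x)Z\<close>.\<close>

lemma centralizer_cosets_not_cover:
  assumes "finite X" "\<one> \<notin> X" "finite Z"
  shows "\<exists>b. \<forall>x\<in>X. \<forall>z\<in>Z. \<forall>c. c \<otimes> x = x \<otimes> c \<longrightarrow> b \<noteq> c \<otimes> z"
  using assms
proof (induction X arbitrary: Z)
  case (insert x X)
  have "\<exists>g. \<forall>z\<in>Z. \<forall>c. c \<otimes> x = x \<otimes> c \<longrightarrow> g \<noteq> c \<otimes> z"
  proof (rule ccontr)
    assume cov: "\<nexists>g. \<forall>z\<in>Z. \<forall>c. c \<otimes> x = x \<otimes> c \<longrightarrow> g \<noteq> c \<otimes> z"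
    have "{inv h \<otimes> x \<otimes> h | h. True} \<subseteq> (\<lambda>z. inv z \<otimes> x \<otimes> z) ` Z"
    proof clarify
      fix h
      obtain z c where z: "z \<in> Z" "c \<otimes> x = x \<otimes> c" "h = c \<otimes> z" using cov by blast
      have "inv c \<otimes> (x \<otimes> c) = x" using z(2) by (metis inv_cancel(1))
      then have "inv h \<otimes> x \<otimes> h = inv z \<otimes> x \<otimes> z"
        unfolding z(3) by (simp add: inv_mult_group) (metis UNIV_I carrier_UNIV m_assoc)
      with z show "inv h \<otimes> x \<otimes> h \<in> (\<lambda>z. inv z \<otimes> x \<otimes> z) ` Z" by blast
    qed
    then have "finite {inv h \<otimes> x \<otimes> h | h. True}"
      using insert.prems(2) by (meson finite_imageI finite_subset)
    with icc[of x] insert.prems show False by auto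
  qed
  then obtain g where g: "\<And>z c. z \<in> Z \<Longrightarrow> c \<otimes> x = x \<otimes> c \<Longrightarrow> g \<noteq> c \<otimes> z" by blast
  \<comment> \<open>The extra representatives allow \<open>b = c \<otimes> z\<close> to be exchanged
    for \<open>c \<otimes> g\<close>: an equation \<open>c \<otimes> g = d \<otimes> z'\<close>
    would give \<open>b = d \<otimes> (z' \<otimes> inv g \<otimes> z)\<close>, which the induction
    hypothesis excludes.\<close>
  define Z' where "Z' = Z \<union> (\<lambda>(z, z'). z \<otimes> inv g \<otimes> z') ` (Z \<times> Z)"
  have "finite Z'" using insert.prems by (simp add: Z'_def)
  then have "\<exists>b. \<forall>y\<in>X. \<forall>z\<in>Z'. \<forall>c. c \<otimes> y = y \<otimes> c \<longrightarrow> b \<noteq> c \<otimes> z"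
    using insert.prems by (intro insert.IH) auto
  then obtain b where b: "\<And>y z c. y \<in> X \<Longrightarrow> z \<in> Z' \<Longrightarrow> c \<otimes> y = y \<otimes> c \<Longrightarrow> b \<noteq> c \<otimes> z"
    by blast
  show ?case
  proof (cases "\<exists>z\<in>Z. \<exists>c. c \<otimes> x = x \<otimes> c \<and> b = c \<otimes> z")
    case True
    then obtain z c where z: "z \<in> Z" "c \<otimes> x = x \<otimes> c" "b = c \<otimes> z" by blast
    have "c \<otimes> g \<noteq> d \<otimes> z'" if "y \<in> insert x X" "z' \<in> Z" "d \<otimes> y = y \<otimes> d" for y z' d
    proof
      assume eq: "c \<otimes> g = d \<otimes> z'"
      show False
      proof (cases "y = x")
        case True
        have "inv c \<otimes> d \<otimes> x = x \<otimes> (inv c \<otimes> d)"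
        proof -
          have "inv c \<otimes> (d \<otimes> x) = inv c \<otimes> (x \<otimes> c \<otimes> (inv c \<otimes> d))"
            using that(3) True by (simp add: m_assoc)
          also have "\<dots> = x \<otimes> (inv c \<otimes> d)" by (simp add: m_assoc flip: z(2))
          finally show ?thesis by (simp add: m_assoc)
        qed
        then have "g \<noteq> inv c \<otimes> d \<otimes> z'" using g that(2) by blast
        moreover have "g = inv c \<otimes> (c \<otimes> g)" by simp
        ultimately show False using eq by (simp add: m_assoc)
      next
        case False
        then have "y \<in> X" using that by simp
        have "z' \<otimes> inv g \<otimes> z \<in> Z'" using that z by (force simp: Z'_def)
        with b[OF \<open>y \<in> X\<close> _ that(3)] have "b \<noteq> d \<otimes> (z' \<otimes> inv g \<otimes> z)" by blast
        moreover have "d \<otimes> (z' \<otimes> inv g \<otimes> z) = (d \<otimes> z') \<otimes> inv g \<otimes> z" by (simp add: m_assoc)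
        moreover have "\<dots> = b" unfolding eq[symmetric] z(3) by (simp add: m_assoc)
        ultimately show False by simp
      qed
    qed
    then show ?thesis by blast
  next
    case False
    with b show ?thesis by (intro exI[of _ b]) (auto simp: Z'_def)
  qed
qed simp

text \<open>For fixed \<open>x\<close> and \<open>y\<close> the solutions \<open>c\<close> of
  \<open>inv c \<otimes> x \<otimes> c = y\<close> are empty or a single coset of the centralizer of
  \<open>x\<close>. The elements to avoid thus lie in finitely many such cosets.\<close>

lemma conjugates_avoid:
  assumes "finite X" "\<one> \<notin> X" "finite Y" "finite Z"
  shows "\<exists>c. c \<notin> Z \<and> (\<forall>x\<in>X. inv c \<otimes> x \<otimes> c \<notin> Y)"
proof -
  obtain g where g: "g \<noteq> \<one>" using nontrivial by blast
  define w where "w x y = (SOME c. inv c \<otimes> x \<otimes> c = y)" for x y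
  \<comment> \<open>The additional \<open>g\<close> secures \<open>b \<notin> Z\<close> even if
    \<open>X\<close> is empty: take the centralizing element to be \<open>\<one>\<close>.\<close>
  have "\<exists>b. \<forall>x\<in>insert g X. \<forall>z\<in>Z \<union> (\<lambda>(x, y). w x y) ` (X \<times> Y). \<forall>c. c \<otimes> x = x \<otimes> c \<longrightarrow> b \<noteq> c \<otimes> z"
    using assms g by (intro centralizer_cosets_not_cover) auto
  then obtain b where b: "\<And>x z c. x \<in> insert g X \<Longrightarrow> z \<in> Z \<union> (\<lambda>(x, y). w x y) ` (X \<times> Y) \<Longrightarrow>
      c \<otimes> x = x \<otimes> c \<Longrightarrow> b \<noteq> c \<otimes> z"
    by blast
  have "b \<notin> Z" using b[of g b \<one>] by auto
  moreover have "inv b \<otimes> x \<otimes> b \<notin> Y" if x: "x \<in> X" for x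
  proof
    assume y: "inv b \<otimes> x \<otimes> b \<in> Y"
    define d where "d = w x (inv b \<otimes> x \<otimes> b)"
    have d: "inv d \<otimes> x \<otimes> d = inv b \<otimes> x \<otimes> b"
      unfolding d_def w_def by (rule someI[of _ b]) simp
    have "(b \<otimes> inv d) \<otimes> x = b \<otimes> (inv d \<otimes> x \<otimes> d) \<otimes> inv d" by (simp add: m_assoc)
    also have "\<dots> = x \<otimes> (b \<otimes> inv d)" unfolding d by (simp add: m_assoc)
    finally have "b \<noteq> (b \<otimes> inv d) \<otimes> d"
      using x y by (intro b[of x]) (auto simp: d_def)
    then show False by (simp add: m_assoc)
  qed
  ultimately show ?thesis by blast
qed

text \<open>Points are added one at a time. For the finitely many \<open>h\<close> under which old
  points already interact, the new point is kept out of every interaction. For any other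
  \<open>h\<close> only the new point itself and at most one old point can count, because the
  \<open>E\<close>-neighbourhoods are disjoint; this gives the bound 2.\<close>

lemma generic_set:
  assumes finE: "finite E" and one: "\<one> \<in> E" and sym: "\<forall>x\<in>E. inv x \<in> E"
  shows "\<exists>B. finite B \<and> card B = n \<and>
    (\<forall>b\<in>B. \<forall>b'\<in>B. \<forall>e\<in>E. \<forall>e'\<in>E. b \<otimes> e = b' \<otimes> e' \<longrightarrow> b = b') \<and>
    (\<forall>h. h \<noteq> \<one> \<longrightarrow> card {b \<in> B. \<exists>b'\<in>B. inv (h \<otimes> b) \<otimes> b' \<in> E} \<le> 2)"
proof (induction n)
  case (Suc n)
  then obtain B where finB: "finite B" and cardB: "card B = n"
    and disj: "\<And>b b' e e'. b \<in> B \<Longrightarrow> b' \<in> B \<Longrightarrow> e \<in> E \<Longrightarrow> e' \<in> E \<Longrightarrow> b \<otimes> e = b' \<otimes> e' \<Longrightarrow> b = b'"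
    and two: "\<And>h. h \<noteq> \<one> \<Longrightarrow> card {b \<in> B. \<exists>b'\<in>B. inv (h \<otimes> b) \<otimes> b' \<in> E} \<le> 2"
    by blast
  define D where "D = (\<lambda>(b, e, b'). b' \<otimes> inv e \<otimes> inv b) ` (B \<times> E \<times> B)"
  \<comment> \<open>The three pieces keep the neighbourhood of \<open>c\<close> disjoint from those
    of the old points and, for \<open>h \<in> D\<close>, keep \<open>c\<close> away from the points
    \<open>h \<otimes> b\<close> and \<open>h \<otimes> c\<close> away from \<open>B\<close>. The
    remaining pair, \<open>h \<otimes> c\<close> against \<open>c\<close>, is a matter of the
    conjugate of \<open>h\<close> by \<open>c\<close>, handled by \<open>conj\<close> and the
    symmetry of \<open>E\<close>.\<close>
  define Z where "Z = (\<lambda>(b, e, e'). b \<otimes> e \<otimes> inv e') ` (B \<times> E \<times> E)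
      \<union> (\<lambda>(h, b, e). h \<otimes> b \<otimes> e) ` (D \<times> B \<times> E) \<union> (\<lambda>(h, b, e). inv h \<otimes> b \<otimes> inv e) ` (D \<times> B \<times> E)"
  have finD: "finite D" using finB finE by (simp add: D_def)
  have "finite Z" using finD finB finE by (simp add: Z_def)
  then obtain c where c: "c \<notin> Z" and conj: "\<And>x. x \<in> D - {\<one>} \<Longrightarrow> inv c \<otimes> x \<otimes> c \<notin> E"
    using conjugates_avoid[of "D - {\<one>}" E Z] finD finE by auto
  have DI: "h \<in> D" if "b \<in> B" "b' \<in> B" "inv (h \<otimes> b) \<otimes> b' \<in> E" for h b b'
  proof -
    have "h = b' \<otimes> inv (inv (h \<otimes> b) \<otimes> b') \<otimes> inv b" by (simp add: inv_mult_group m_assoc)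
    then show ?thesis unfolding D_def using that
      by (intro image_eqI[where x = "(b, inv (h \<otimes> b) \<otimes> b', b')"]) auto
  qed
  have cnotB: "c \<notin> B"
  proof
    assume "c \<in> B"
    then have "c \<in> Z" unfolding Z_def using one
      by (intro UnI1 image_eqI[where x = "(c, \<one>, \<one>)"]) auto
    with c show False by simp
  qed
  have newdisj: "b \<otimes> e \<noteq> c \<otimes> e'" if "b \<in> B" "e \<in> E" "e' \<in> E" for b e e'
  proof
    assume "b \<otimes> e = c \<otimes> e'"
    then have "c = b \<otimes> e \<otimes> inv e'" by (simp add: m_assoc)
    then have "c \<in> Z" unfolding Z_def using that
      by (intro UnI1 image_eqI[where x = "(b, e, e')"]) auto
    with c show False by simp
  qed
  have "card {b \<in> insert c B. \<exists>b'\<in>insert c B. inv (h \<otimes> b) \<otimes> b' \<in> E} \<le> 2" if h: "h \<noteq> \<one>" for h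
  proof (cases "h \<in> D")
    case True
    have "inv (h \<otimes> c) \<otimes> c \<notin> E"
    proof
      assume "inv (h \<otimes> c) \<otimes> c \<in> E"
      with sym have "inv (inv (h \<otimes> c) \<otimes> c) \<in> E" by blast
      then have "inv c \<otimes> h \<otimes> c \<in> E" by (simp add: inv_mult_group m_assoc)
      with conj True h show False by simp
    qed
    moreover have "inv (h \<otimes> b) \<otimes> c \<notin> E" if "b \<in> B" for b
    proof
      assume e: "inv (h \<otimes> b) \<otimes> c \<in> E"
      have "c = h \<otimes> b \<otimes> (inv (h \<otimes> b) \<otimes> c)" by simp
      then have "c \<in> Z" unfolding Z_def using that e True
        by (intro UnI1 UnI2 image_eqI[where x = "(h, b, inv (h \<otimes> b) \<otimes> c)"]) auto
      with c show False by simp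
    qed
    moreover have "inv (h \<otimes> c) \<otimes> b \<notin> E" if "b \<in> B" for b
    proof
      assume e: "inv (h \<otimes> c) \<otimes> b \<in> E"
      have "c = inv h \<otimes> b \<otimes> inv (inv (h \<otimes> c) \<otimes> b)" by (simp add: inv_mult_group m_assoc)
      then have "c \<in> Z" unfolding Z_def using that e True
        by (intro UnI2 image_eqI[where x = "(h, b, inv (h \<otimes> c) \<otimes> b)"]) auto
      with c show False by simp
    qed
    ultimately have "{b \<in> insert c B. \<exists>b'\<in>insert c B. inv (h \<otimes> b) \<otimes> b' \<in> E} =
        {b \<in> B. \<exists>b'\<in>B. inv (h \<otimes> b) \<otimes> b' \<in> E}"
      by blast
    then show ?thesis using two[OF h] by simp
  next
    case False
    let ?S = "{b \<in> B. inv (h \<otimes> b) \<otimes> c \<in> E}"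
    have "b = b'" if b: "b \<in> ?S" "b' \<in> ?S" for b b'
    proof -
      have "b \<otimes> (inv (h \<otimes> b) \<otimes> c) = b' \<otimes> (inv (h \<otimes> b') \<otimes> c)"
        by (simp add: inv_mult_group m_assoc)
      then show ?thesis using disj b by blast
    qed
    then have "card ?S \<le> 1" using finB by (simp add: card_le_Suc0_iff_eq)
    moreover have "{b \<in> insert c B. \<exists>b'\<in>insert c B. inv (h \<otimes> b) \<otimes> b' \<in> E} \<subseteq> insert c ?S"
      using DI False by blast
    then have "card {b \<in> insert c B. \<exists>b'\<in>insert c B. inv (h \<otimes> b) \<otimes> b' \<in> E} \<le> card (insert c ?S)"
      using finB by (intro card_mono) auto
    ultimately show ?thesis using card_insert_le_m1[of 2 ?S c] by simp
  qed
  moreover have "\<forall>b\<in>insert c B. \<forall>b'\<in>insert c B. \<forall>e\<in>E. \<forall>e'\<in>E. b \<otimes> e = b' \<otimes> e' \<longrightarrow> b = b'"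
    using disj newdisj by (metis insert_iff)
  ultimately show ?case
    using finB cnotB cardB by (intro exI[of _ "insert c B"]) simp
qed (use finE in auto)

end

section \<open>Systems of extendable patterns\<close>

context full_group
begin

text \<open>The value type is left open so that partial patterns, with optional values, and full
  configurations share one translation.\<close>

definition shift :: "'a \<Rightarrow> ('a \<Rightarrow> 'c) \<Rightarrow> 'a \<Rightarrow> 'c" where
  "shift h s = (\<lambda>x. s (inv h \<otimes> x))"

lemma shift_shift: "shift g (shift h s) = shift (g \<otimes> h) s"
  by (simp add: shift_def inv_mult_group m_assoc)

lemma shift_one [simp]: "shift \<one> s = s"
  by (simp add: shift_def)

lemma dom_shift: "dom (shift h s) = (\<lambda>x. h \<otimes> x) ` dom s"
proof
  show "dom (shift h s) \<subseteq> (\<lambda>x. h \<otimes> x) ` dom s"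
  proof
    fix x assume "x \<in> dom (shift h s)"
    then show "x \<in> (\<lambda>x. h \<otimes> x) ` dom s"
      by (intro image_eqI[where x = "inv h \<otimes> x"]) (auto simp: shift_def)
  qed
qed (auto simp: shift_def)

lemma shift_map_le: "s \<subseteq>\<^sub>m t \<Longrightarrow> shift h s \<subseteq>\<^sub>m shift h t"
  unfolding map_le_def dom_shift by (auto simp: shift_def)

text \<open>\<open>K\<close> acts as a ball around the identity for a left-invariant notion of
  distance.\<close>

definition far :: "'a set \<Rightarrow> ('a \<Rightarrow> 'c option) \<Rightarrow> ('a \<Rightarrow> 'c option) \<Rightarrow> bool" where
  "far K s t \<longleftrightarrow> (\<forall>x\<in>dom s. \<forall>y\<in>dom t. inv x \<otimes> y \<notin> K)"

text \<open>The locality bound \<open>dom t \<subseteq> F <#> D\<close> is what makes the notion iterable: it controls how much of the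
  group an extension occupies before the extension is chosen.\<close>

definition extension_system :: "('a \<Rightarrow> 'c option) set \<Rightarrow> 'a set \<Rightarrow> 'a set \<Rightarrow> bool" where
  "extension_system \<E> K D \<longleftrightarrow> finite K \<and> finite D \<and> \<one> \<in> K \<and> (\<forall>x\<in>K. inv x \<in> K) \<and>
     (\<forall>s\<in>\<E>. finite (dom s)) \<and> (\<forall>h. \<forall>s\<in>\<E>. shift h s \<in> \<E>) \<and>
     (\<forall>\<F> F. finite \<F> \<and> \<F> \<subseteq> \<E> \<and> pairwise (far K) \<F> \<and> finite F \<and> (\<Union>s\<in>\<F>. dom s) \<subseteq> F \<longrightarrow>
        (\<exists>t\<in>\<E>. F \<subseteq> dom t \<and> dom t \<subseteq> F <#> D \<and> (\<forall>s\<in>\<F>. s \<subseteq>\<^sub>m t)))"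

lemma extension_systemD:
  assumes "extension_system \<E> K D"
  shows "finite K" "finite D" "\<one> \<in> K" "\<And>x. x \<in> K \<Longrightarrow> inv x \<in> K" "\<And>s. s \<in> \<E> \<Longrightarrow> finite (dom s)"
    "\<And>h s. s \<in> \<E> \<Longrightarrow> shift h s \<in> \<E>"
  using assms unfolding extension_system_def by simp_all

lemma extension_system_extend:
  assumes "extension_system \<E> K D" "finite \<F>" "\<F> \<subseteq> \<E>" "pairwise (far K) \<F>" "finite F" "(\<Union>s\<in>\<F>. dom s) \<subseteq> F"
  shows "\<exists>t\<in>\<E>. F \<subseteq> dom t \<and> dom t \<subseteq> F <#> D \<and> (\<forall>s\<in>\<F>. s \<subseteq>\<^sub>m t)"
proof -
  have "\<forall>\<F> F. finite \<F> \<and> \<F> \<subseteq> \<E> \<and> pairwise (far K) \<F> \<and> finite F \<and> (\<Union>s\<in>\<F>. dom s) \<subseteq> F \<longrightarrow>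
        (\<exists>t\<in>\<E>. F \<subseteq> dom t \<and> dom t \<subseteq> F <#> D \<and> (\<forall>s\<in>\<F>. s \<subseteq>\<^sub>m t))"
    using assms(1) unfolding extension_system_def by (elim conjE)
  with assms(2-) show ?thesis by blast
qed

end

context full_icc_group
begin

text \<open>A translate \<open>h B\<close> of the new set \<open>B\<close> must contain an occurrence of \<open>p\<close>, unless a third of its places
  are still free of the domain. Since \<open>B\<close> is generic, the pattern with \<open>p\<close> at all places of \<open>B\<close> blocks at
  most two places of every other translate, so it obeys this rule.\<close>

lemma extension_system_step:
  fixes p :: "'a \<Rightarrow> 'c option"
  assumes sys: "extension_system \<E> K D" and p: "p \<in> \<E>" "dom p \<noteq> {}"
  obtains B \<E>' K' D' q where "finite B" "\<E>' \<subseteq> \<E>" "extension_system \<E>' K' D'"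
    "q \<in> \<E>'" "\<forall>b\<in>B. shift b p \<subseteq>\<^sub>m q"
    "\<forall>s\<in>\<E>'. \<forall>h. (\<forall>b\<in>B. \<forall>v\<in>dom p. h \<otimes> b \<otimes> v \<in> dom s) \<longrightarrow> (\<exists>b\<in>B. shift (h \<otimes> b) p \<subseteq>\<^sub>m s)"
proof -
  note fin = extension_systemD(1,2)[OF sys] and K1 = extension_systemD(3)[OF sys]
    and Kinv = extension_systemD(4)[OF sys] and Efin = extension_systemD(5)[OF sys]
    and Eshift = extension_systemD(6)[OF sys] and Eext = extension_system_extend[OF sys]
  let ?S = "dom p"
  have finS: "finite ?S" using Efin p by blast
  \<comment> \<open>A place \<open>g\<close> is blocked when a copy of \<open>p\<close> put there
    would come too close to \<open>T\<close>.\<close>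
  define blocked where "blocked g T \<longleftrightarrow> (\<exists>v\<in>?S. \<exists>t\<in>T. inv (g \<otimes> v) \<otimes> t \<in> K)" for g T
  \<comment> \<open>Avoiding the first family of differences makes copies of \<open>p\<close> far
    apart. The second family accounts for the surroundings \<open>D\<close> that an extension may
    add around a copy, so that separation modulo \<open>E\<close> also prevents blocking by those
    surroundings.\<close>
  define E\<^sub>0 where "E\<^sub>0 = insert \<one> ((\<lambda>(v, x, v'). v \<otimes> x \<otimes> inv v') ` (?S \<times> K \<times> ?S) \<union>
      (\<lambda>(v, x, d, v'). v \<otimes> x \<otimes> inv d \<otimes> inv v') ` (?S \<times> K \<times> D \<times> ?S))"
  define E where "E = E\<^sub>0 \<union> (\<lambda>x. inv x) ` E\<^sub>0"
  have finE: "finite E" using fin finS by (simp add: E_def E\<^sub>0_def)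
  have oneE: "\<one> \<in> E" by (simp add: E_def E\<^sub>0_def)
  have symE: "\<forall>x\<in>E. inv x \<in> E" by (auto simp: E_def)
  have E1: "inv g \<otimes> l \<in> E" if "v \<in> ?S" "v' \<in> ?S" "inv (g \<otimes> v) \<otimes> (l \<otimes> v') \<in> K" for g l v v'
  proof -
    have "inv g \<otimes> l = v \<otimes> (inv (g \<otimes> v) \<otimes> (l \<otimes> v')) \<otimes> inv v'"
      by (simp add: inv_mult_group m_assoc)
    then show ?thesis unfolding E_def E\<^sub>0_def using that
      by (intro UnI1 insertI2 image_eqI[where x = "(v, inv (g \<otimes> v) \<otimes> (l \<otimes> v'), v')"]) auto
  qed
  have E2: "inv g \<otimes> l \<in> E" if "v \<in> ?S" "v' \<in> ?S" "d \<in> D" "inv (g \<otimes> v) \<otimes> (l \<otimes> v' \<otimes> d) \<in> K"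
    for g l v v' d
  proof -
    have "inv g \<otimes> l = v \<otimes> (inv (g \<otimes> v) \<otimes> (l \<otimes> v' \<otimes> d)) \<otimes> inv d \<otimes> inv v'"
      by (simp add: inv_mult_group m_assoc)
    then show ?thesis unfolding E_def E\<^sub>0_def using that
      by (intro UnI1 insertI2 UnI2 image_eqI[where x = "(v, inv (g \<otimes> v) \<otimes> (l \<otimes> v' \<otimes> d), d, v')"]) auto
  qed
  have blockedE: "inv g \<otimes> l \<in> E" if "blocked g ((\<lambda>v. l \<otimes> v) ` ?S <#> D)" for g l
    using that E2[of _ _ _ g l] unfolding blocked_def set_mult_def by blast
  have blocked_mono: "blocked g T \<Longrightarrow> T \<subseteq> T' \<Longrightarrow> blocked g T'" for g T T'
    unfolding blocked_def by blast
  have farp: "far K (shift l p) (shift l' p)" if "inv l \<otimes> l' \<notin> E" for l l'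
    using E1[of _ _ l l'] that unfolding far_def dom_shift by blast
  from sparse_hitting_set[OF finE oneE] obtain m where "0 < m" and
    sel: "\<forall>B H Bh. finite B \<and> card B = 6 * m \<and>
      (\<forall>b\<in>B. \<forall>b'\<in>B. \<forall>e\<in>E. \<forall>e'\<in>E. b \<otimes> e = b' \<otimes> e' \<longrightarrow> b = b') \<and>
      finite H \<and> (\<forall>h\<in>H. Bh h \<subseteq> B \<and> 2 * m \<le> card (Bh h)) \<longrightarrow>
      (\<exists>L. L \<subseteq> {h \<otimes> b | h b. h \<in> H \<and> b \<in> Bh h} \<and> (\<forall>l\<in>L. \<forall>l'\<in>L. l \<noteq> l' \<longrightarrow> inv l \<otimes> l' \<notin> E) \<and>
        (\<forall>h\<in>H. \<exists>b\<in>Bh h. h \<otimes> b \<in> L) \<and> (\<forall>h. card {b \<in> B. \<exists>l\<in>L. inv (h \<otimes> b) \<otimes> l \<in> E} \<le> m))"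
    by (elim exE conjE) (rule that)
  from generic_set[OF finE oneE symE, of "6 * m"] obtain B where finB: "finite B" and cardB: "card B = 6 * m"
    and disj: "\<And>b b' e e'. b \<in> B \<Longrightarrow> b' \<in> B \<Longrightarrow> e \<in> E \<Longrightarrow> e' \<in> E \<Longrightarrow> b \<otimes> e = b' \<otimes> e' \<Longrightarrow> b = b'"
    and two: "\<And>h. h \<noteq> \<one> \<Longrightarrow> card {b \<in> B. \<exists>b'\<in>B. inv (h \<otimes> b) \<otimes> b' \<in> E} \<le> 2"
    by blast
  have Bne: "B \<noteq> {}" using cardB \<open>0 < m\<close> by auto
  define hit where "hit h s \<longleftrightarrow> (\<exists>b\<in>B. shift (h \<otimes> b) p \<subseteq>\<^sub>m s)" for h s
  \<comment> \<open>The allowance splits into \<open>3 * m\<close> places blocked by the prescribed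
    domain with its surroundings and \<open>m\<close> blocked by inserted copies. The other
    \<open>2 * m\<close> of the \<open>6 * m\<close> places are what \<open>sel\<close>
    requires.\<close>
  define \<E>' where "\<E>' = {s \<in> \<E>. \<forall>h. hit h s \<or> card {b \<in> B. blocked (h \<otimes> b) (dom s)} \<le> 4 * m}"
  \<comment> \<open>If two patterns both block places of one translate of \<open>B\<close>, a point
    of the first and a point of the second differ by an element of \<open>Y\<close>. In a family
    that is far for \<open>K'\<close>, each translate is therefore blocked by one member at most,
    and the bound \<open>4 * m\<close> of that member carries over to the union.\<close>
  define Y where "Y = (\<lambda>(x, v, b, b', v', x'). inv x \<otimes> inv v \<otimes> inv b \<otimes> b' \<otimes> v' \<otimes> x') `
      (K \<times> ?S \<times> B \<times> B \<times> ?S \<times> K)"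
  define K' where "K' = K \<union> Y \<union> (\<lambda>x. inv x) ` Y"
  \<comment> \<open>Copies go only into translates near \<open>F <#> D\<close>. The product leads
    from \<open>F\<close> back to such an \<open>h\<close>, on to a place of its translate, and out
    to the surroundings of the copy placed there.\<close>
  define D' where "D' = D \<union> (\<lambda>(d, x, v, b, b', v', d'). d \<otimes> inv x \<otimes> inv v \<otimes> inv b \<otimes> b' \<otimes> v' \<otimes> d') `
      (D \<times> K \<times> ?S \<times> B \<times> B \<times> ?S \<times> D)"
  have K'I: "inv t \<otimes> t' \<in> K'" if "b \<in> B" "b' \<in> B" "v \<in> ?S" "v' \<in> ?S"
    "inv (h \<otimes> b \<otimes> v) \<otimes> t \<in> K" "inv (h \<otimes> b' \<otimes> v') \<otimes> t' \<in> K" for h b b' v v' t t'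
  proof -
    have "inv t \<otimes> t' = inv (inv (h \<otimes> b \<otimes> v) \<otimes> t) \<otimes> inv v \<otimes> inv b \<otimes> b' \<otimes> v' \<otimes> (inv (h \<otimes> b' \<otimes> v') \<otimes> t')"
      by (simp add: inv_mult_group m_assoc)
    then show ?thesis unfolding K'_def Y_def using that
      by (intro UnI1 UnI2 image_eqI[where x = "(inv (h \<otimes> b \<otimes> v) \<otimes> t, v, b, b', v', inv (h \<otimes> b' \<otimes> v') \<otimes> t')"]) auto
  qed
  have ext': "\<exists>t\<in>\<E>'. F \<subseteq> dom t \<and> dom t \<subseteq> F <#> D' \<and> (\<forall>s\<in>\<F>. s \<subseteq>\<^sub>m t)"
    if \<F>: "finite \<F>" "\<F> \<subseteq> \<E>'" "pairwise (far K') \<F>" and F: "finite F" "(\<Union>s\<in>\<F>. dom s) \<subseteq> F" for \<F> F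
  proof -
    \<comment> \<open>Locality enters here: wherever the later extension \<open>t\<close> grows, it
      stays within \<open>F\<^sub>1 <#> D\<close>. So the translates in need of a copy can be listed
      before \<open>t\<close> exists.\<close>
    define H where "H = {h. 3 * m < card {b \<in> B. blocked (h \<otimes> b) (F <#> D)}}"
    define H\<^sub>0 where "H\<^sub>0 = {h \<in> H. \<forall>s\<in>\<F>. \<not> hit h s}"
    define Bh where "Bh h = {b \<in> B. \<not> blocked (h \<otimes> b) (\<Union>s\<in>\<F>. dom s)}" for h
    have HI: "\<exists>f\<in>F. \<exists>d\<in>D. \<exists>x\<in>K. \<exists>v\<in>?S. \<exists>b\<in>B. h = f \<otimes> d \<otimes> inv x \<otimes> inv v \<otimes> inv b" if "h \<in> H" for h
    proof -
      have "card {b \<in> B. blocked (h \<otimes> b) (F <#> D)} \<noteq> 0" using that by (simp add: H_def)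
      then have "{b \<in> B. blocked (h \<otimes> b) (F <#> D)} \<noteq> {}" by (metis card.empty)
      then obtain b where "b \<in> B" "blocked (h \<otimes> b) (F <#> D)" by blast
      moreover from this(2) obtain v t where "v \<in> ?S" "t \<in> F <#> D" "inv (h \<otimes> b \<otimes> v) \<otimes> t \<in> K"
        unfolding blocked_def by blast
      moreover from this(2) obtain f d where "f \<in> F" "d \<in> D" "t = f \<otimes> d"
        unfolding set_mult_def by blast
      moreover have "h = f \<otimes> d \<otimes> inv (inv (h \<otimes> b \<otimes> v) \<otimes> (f \<otimes> d)) \<otimes> inv v \<otimes> inv b"
        by (simp add: inv_mult_group m_assoc)
      ultimately show ?thesis by metis
    qed
    have "H \<subseteq> (\<lambda>(f, d, x, v, b). f \<otimes> d \<otimes> inv x \<otimes> inv v \<otimes> inv b) ` (F \<times> D \<times> K \<times> ?S \<times> B)"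
      using HI by force
    then have finH: "finite H" using F fin finS finB by (auto intro: finite_subset)
    then have finH0: "finite H\<^sub>0" by (simp add: H\<^sub>0_def)
    have Bh: "Bh h \<subseteq> B \<and> 2 * m \<le> card (Bh h)" if h: "h \<in> H\<^sub>0" for h
    proof -
      let ?bl = "{b \<in> B. blocked (h \<otimes> b) (\<Union>s\<in>\<F>. dom s)}"
      have "card ?bl \<le> 4 * m"
      proof (cases "?bl = {}")
        case False
        then obtain b v s t where b: "b \<in> B" "v \<in> ?S" "s \<in> \<F>" "t \<in> dom s" "inv (h \<otimes> b \<otimes> v) \<otimes> t \<in> K"
          unfolding blocked_def by blast
        have "?bl \<subseteq> {b \<in> B. blocked (h \<otimes> b) (dom s)}"
        proof clarify
          fix b' assume b': "b' \<in> B" "blocked (h \<otimes> b') (\<Union>s\<in>\<F>. dom s)"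
          then obtain v' s' t' where *: "v' \<in> ?S" "s' \<in> \<F>" "t' \<in> dom s'" "inv (h \<otimes> b' \<otimes> v') \<otimes> t' \<in> K"
            unfolding blocked_def by blast
          have "inv t \<otimes> t' \<in> K'" using b b' * by (intro K'I)
          then have "s = s'" using \<F>(3) b * unfolding pairwise_def far_def by blast
          with * show "blocked (h \<otimes> b') (dom s)" unfolding blocked_def by blast
        qed
        then have "card ?bl \<le> card {b \<in> B. blocked (h \<otimes> b) (dom s)}"
          using finB by (intro card_mono) auto
        also have "\<dots> \<le> 4 * m" using h b \<F>(2) unfolding H\<^sub>0_def \<E>'_def by auto
        finally show ?thesis .
      qed (metis card.empty le0)
      moreover have "card (Bh h) = card B - card ?bl"
        using finB by (subst card_Diff_subset[symmetric]) (auto simp: Bh_def intro!: arg_cong[of _ _ card])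
      ultimately show ?thesis using cardB by (auto simp: Bh_def)
    qed
    have "\<exists>L. L \<subseteq> {h \<otimes> b | h b. h \<in> H\<^sub>0 \<and> b \<in> Bh h} \<and> (\<forall>l\<in>L. \<forall>l'\<in>L. l \<noteq> l' \<longrightarrow> inv l \<otimes> l' \<notin> E) \<and>
        (\<forall>h\<in>H\<^sub>0. \<exists>b\<in>Bh h. h \<otimes> b \<in> L) \<and> (\<forall>h. card {b \<in> B. \<exists>l\<in>L. inv (h \<otimes> b) \<otimes> l \<in> E} \<le> m)"
      using finB cardB disj finH0 Bh by (intro sel[rule_format]) blast
    then obtain L where
      L: "L \<subseteq> {h \<otimes> b | h b. h \<in> H\<^sub>0 \<and> b \<in> Bh h}"
      and Lsep: "\<forall>l\<in>L. \<forall>l'\<in>L. l \<noteq> l' \<longrightarrow> inv l \<otimes> l' \<notin> E"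
      and Lhit: "\<forall>h\<in>H\<^sub>0. \<exists>b\<in>Bh h. h \<otimes> b \<in> L"
      and Lbl: "\<forall>h. card {b \<in> B. \<exists>l\<in>L. inv (h \<otimes> b) \<otimes> l \<in> E} \<le> m"
      by (elim exE conjE) (rule that)
    have "L \<subseteq> (\<lambda>(h, b). h \<otimes> b) ` (H\<^sub>0 \<times> B)" using L by (force simp: Bh_def)
    then have finL: "finite L" using finH0 finB by (auto intro: finite_subset)
    define \<F>\<^sub>1 where "\<F>\<^sub>1 = \<F> \<union> (\<lambda>l. shift l p) ` L"
    define F\<^sub>1 where "F\<^sub>1 = F \<union> (\<Union>l\<in>L. (\<lambda>v. l \<otimes> v) ` ?S)"
    have mixed: "far K (shift l p) s" "far K s (shift l p)" if "l \<in> L" "s \<in> \<F>" for l s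
    proof -
      obtain h b where "l = h \<otimes> b" "b \<in> Bh h" using L \<open>l \<in> L\<close> by blast
      then have "\<not> blocked l (\<Union>s\<in>\<F>. dom s)" by (simp add: Bh_def)
      then have *: "inv (l \<otimes> v) \<otimes> t \<notin> K" if "v \<in> ?S" "t \<in> dom s" for v t
        using that \<open>s \<in> \<F>\<close> unfolding blocked_def by blast
      then show "far K (shift l p) s" unfolding far_def dom_shift by blast
      have "inv t \<otimes> (l \<otimes> v) \<notin> K" if "v \<in> ?S" "t \<in> dom s" for v t
        using *[OF that] Kinv[of "inv t \<otimes> (l \<otimes> v)"] by (auto simp: inv_mult_group m_assoc)
      then show "far K s (shift l p)" unfolding far_def dom_shift by blast
    qed
    have old: "far K s t" if "s \<in> \<F>" "t \<in> \<F>" "s \<noteq> t" for s t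
      using \<F>(3) that unfolding pairwise_def far_def K'_def by blast
    have new: "far K (shift l p) (shift l' p)" if "l \<in> L" "l' \<in> L" "shift l p \<noteq> shift l' p" for l l'
      using farp Lsep that by metis
    have "pairwise (far K) \<F>\<^sub>1"
      unfolding pairwise_def \<F>\<^sub>1_def using old new mixed by blast
    moreover have "\<F>\<^sub>1 \<subseteq> \<E>" using \<F>(2) Eshift p unfolding \<F>\<^sub>1_def \<E>'_def by blast
    moreover have "finite \<F>\<^sub>1" "finite F\<^sub>1" using \<F> F finL finS by (simp_all add: \<F>\<^sub>1_def F\<^sub>1_def)
    moreover have "(\<Union>s\<in>\<F>\<^sub>1. dom s) \<subseteq> F\<^sub>1"
      using F(2) unfolding \<F>\<^sub>1_def F\<^sub>1_def by (auto simp: dom_shift)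
    ultimately obtain t where t: "t \<in> \<E>" "F\<^sub>1 \<subseteq> dom t" "dom t \<subseteq> F\<^sub>1 <#> D" "\<And>s. s \<in> \<F>\<^sub>1 \<Longrightarrow> s \<subseteq>\<^sub>m t"
      using Eext[of \<F>\<^sub>1 F\<^sub>1] by blast
    have hits: "hit h t" if "h \<in> H" for h
    proof (cases "\<exists>s\<in>\<F>. hit h s")
      case True
      then show ?thesis using t(4) unfolding hit_def \<F>\<^sub>1_def by (blast intro: map_le_trans)
    next
      case False
      then have "h \<in> H\<^sub>0" using that by (simp add: H\<^sub>0_def)
      then show ?thesis using Lhit t(4) unfolding hit_def \<F>\<^sub>1_def Bh_def by blast
    qed
    have F1D: "F\<^sub>1 <#> D = (F <#> D) \<union> (\<Union>l\<in>L. (\<lambda>v. l \<otimes> v) ` ?S <#> D)"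
      unfolding F\<^sub>1_def set_mult_def by blast
    have "card {b \<in> B. blocked (h \<otimes> b) (dom t)} \<le> 4 * m" if "h \<notin> H" for h
    proof -
      have "{b \<in> B. blocked (h \<otimes> b) (dom t)} \<subseteq> {b \<in> B. blocked (h \<otimes> b) (F <#> D)} \<union>
          {b \<in> B. \<exists>l\<in>L. inv (h \<otimes> b) \<otimes> l \<in> E}"
      proof clarify
        fix b assume b: "b \<in> B" "blocked (h \<otimes> b) (dom t)" and n: "\<not> (\<exists>l\<in>L. inv (h \<otimes> b) \<otimes> l \<in> E)"
        have "blocked (h \<otimes> b) (F\<^sub>1 <#> D)" using b(2) t(3) by (rule blocked_mono)
        then consider "blocked (h \<otimes> b) (F <#> D)" | l where "l \<in> L" "blocked (h \<otimes> b) ((\<lambda>v. l \<otimes> v) ` ?S <#> D)"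
          unfolding F1D blocked_def by blast
        then show "blocked (h \<otimes> b) (F <#> D)"
          by cases (use n blockedE in blast)+
      qed
      then have "card {b \<in> B. blocked (h \<otimes> b) (dom t)} \<le> card ({b \<in> B. blocked (h \<otimes> b) (F <#> D)} \<union>
          {b \<in> B. \<exists>l\<in>L. inv (h \<otimes> b) \<otimes> l \<in> E})"
        using finB by (intro card_mono) auto
      also have "\<dots> \<le> card {b \<in> B. blocked (h \<otimes> b) (F <#> D)} + card {b \<in> B. \<exists>l\<in>L. inv (h \<otimes> b) \<otimes> l \<in> E}"
        by (rule card_Un_le)
      also have "\<dots> \<le> 3 * m + m"
        using that Lbl unfolding H_def by (intro add_mono) auto
      finally show ?thesis by simp
    qed
    with hits t(1) have "t \<in> \<E>'" unfolding \<E>'_def by blast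
    moreover have "F \<subseteq> dom t" using t(2) by (auto simp: F\<^sub>1_def)
    moreover have "F\<^sub>1 <#> D \<subseteq> F <#> D'"
    proof
      fix y assume "y \<in> F\<^sub>1 <#> D"
      then have "y \<in> F <#> D \<or> (\<exists>l\<in>L. \<exists>v\<in>?S. \<exists>d\<in>D. y = l \<otimes> v \<otimes> d)"
        unfolding F1D by (auto simp: set_mult_def)
      then consider "y \<in> F <#> D" | l v d where "l \<in> L" "v \<in> ?S" "d \<in> D" "y = l \<otimes> v \<otimes> d"
        by metis
      then show "y \<in> F <#> D'"
      proof cases
        case 1
        then show ?thesis unfolding set_mult_def D'_def by blast
      next
        case 2
        obtain h b where h: "l = h \<otimes> b" "h \<in> H" "b \<in> B" using L 2 unfolding H\<^sub>0_def Bh_def by blast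
        obtain f d' x v' b' where *: "f \<in> F" "d' \<in> D" "x \<in> K" "v' \<in> ?S" "b' \<in> B"
          "h = f \<otimes> d' \<otimes> inv x \<otimes> inv v' \<otimes> inv b'" using HI[OF h(2)] by blast
        have "d' \<otimes> inv x \<otimes> inv v' \<otimes> inv b' \<otimes> b \<otimes> v \<otimes> d \<in> D'"
          unfolding D'_def using 2 h * by (intro UnI2 image_eqI[where x = "(d', x, v', b', b, v, d)"]) auto
        moreover have "y = f \<otimes> (d' \<otimes> inv x \<otimes> inv v' \<otimes> inv b' \<otimes> b \<otimes> v \<otimes> d)"
          using 2 h * by (simp add: m_assoc)
        ultimately show ?thesis unfolding set_mult_def using *(1) by blast
      qed
    qed
    then have "dom t \<subseteq> F <#> D'" using t(3) by blast
    moreover have "\<forall>s\<in>\<F>. s \<subseteq>\<^sub>m t" using t(4) by (simp add: \<F>\<^sub>1_def)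
    ultimately show ?thesis by blast
  qed
  have shift': "shift g s \<in> \<E>'" if s: "s \<in> \<E>'" for g s
  proof -
    have "hit h (shift g s) \<or> card {b \<in> B. blocked (h \<otimes> b) (dom (shift g s))} \<le> 4 * m" for h
    proof (cases "hit (inv g \<otimes> h) s")
      case True
      then obtain b where b: "b \<in> B" "shift (inv g \<otimes> h \<otimes> b) p \<subseteq>\<^sub>m s" by (auto simp: hit_def)
      have "shift g (shift (inv g \<otimes> h \<otimes> b) p) \<subseteq>\<^sub>m shift g s" using b by (intro shift_map_le)
      then show ?thesis using b unfolding hit_def by (auto simp: shift_shift m_assoc)
    next
      case False
      have "blocked (h \<otimes> b) (dom (shift g s)) = blocked (inv g \<otimes> h \<otimes> b) (dom s)" for b
        unfolding blocked_def dom_shift by (simp add: inv_mult_group m_assoc)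
      then show ?thesis using s False unfolding \<E>'_def by auto
    qed
    then show ?thesis using s Eshift unfolding \<E>'_def by auto
  qed
  have sys': "extension_system \<E>' K' D'"
    unfolding extension_system_def
  proof (intro conjI ballI allI impI)
    show "finite K'" "finite D'" using fin finS finB by (simp_all add: K'_def Y_def D'_def)
    show "\<one> \<in> K'" using K1 by (simp add: K'_def)
    show "inv x \<in> K'" if "x \<in> K'" for x using that Kinv by (auto simp: K'_def)
    show "finite (dom s)" if "s \<in> \<E>'" for s using that Efin by (simp add: \<E>'_def)
    show "shift h s \<in> \<E>'" if "s \<in> \<E>'" for h s using that by (rule shift')
    show "\<exists>t\<in>\<E>'. F \<subseteq> dom t \<and> dom t \<subseteq> F <#> D' \<and> (\<forall>s\<in>\<F>. s \<subseteq>\<^sub>m t)"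
      if "finite \<F> \<and> \<F> \<subseteq> \<E>' \<and> pairwise (far K') \<F> \<and> finite F \<and> (\<Union>s\<in>\<F>. dom s) \<subseteq> F" for \<F> F
      using that by (intro ext') simp_all
  qed
  \<comment> \<open>The copies on \<open>B\<close> themselves are a hit for
    \<open>h = \<one>\<close>. For every other \<open>h\<close>, genericity leaves at most two
    blocked places, within the allowance as \<open>0 < m\<close>.\<close>
  obtain q where q: "q \<in> \<E>'" "\<forall>b\<in>B. shift b p \<subseteq>\<^sub>m q"
  proof -
    define F where "F = (\<Union>b\<in>B. (\<lambda>v. b \<otimes> v) ` ?S)"
    have "far K (shift b p) (shift b' p)" if "b \<in> B" "b' \<in> B" "b \<noteq> b'" for b b'
    proof (rule farp)
      show "inv b \<otimes> b' \<notin> E"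
      proof
        assume "inv b \<otimes> b' \<in> E"
        then have "b = b'" using that oneE by (intro disj[of b b' "inv b \<otimes> b'" \<one>]) auto
        with that show False by simp
      qed
    qed
    then have "pairwise (far K) ((\<lambda>b. shift b p) ` B)" unfolding pairwise_def by blast
    moreover have "finite F" using finB finS by (simp add: F_def)
    moreover have "(\<Union>s\<in>(\<lambda>b. shift b p) ` B. dom s) \<subseteq> F" by (auto simp: F_def dom_shift)
    moreover have "(\<lambda>b. shift b p) ` B \<subseteq> \<E>" using Eshift[OF p(1)] by blast
    ultimately have "\<exists>t\<in>\<E>. F \<subseteq> dom t \<and> dom t \<subseteq> F <#> D \<and> (\<forall>s\<in>(\<lambda>b. shift b p) ` B. s \<subseteq>\<^sub>m t)"
      using finB by (intro Eext) simp_all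
    then obtain t where t: "t \<in> \<E>" "dom t \<subseteq> F <#> D" "\<And>b. b \<in> B \<Longrightarrow> shift b p \<subseteq>\<^sub>m t"
      by auto
    have "hit h t \<or> card {b \<in> B. blocked (h \<otimes> b) (dom t)} \<le> 4 * m" for h
    proof (cases "h = \<one>")
      case True
      then show ?thesis using Bne t(3) by (auto simp: hit_def)
    next
      case False
      have FD: "F <#> D = (\<Union>b\<in>B. (\<lambda>v. b \<otimes> v) ` ?S <#> D)" unfolding F_def set_mult_def by blast
      have "\<exists>b'\<in>B. inv (h \<otimes> b) \<otimes> b' \<in> E" if "blocked (h \<otimes> b) (dom t)" for b
      proof -
        have "blocked (h \<otimes> b) (F <#> D)" using that t(2) by (rule blocked_mono)
        then obtain b' where "b' \<in> B" "blocked (h \<otimes> b) ((\<lambda>v. b' \<otimes> v) ` ?S <#> D)"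
          unfolding FD blocked_def by blast
        then show ?thesis using blockedE by blast
      qed
      then have "card {b \<in> B. blocked (h \<otimes> b) (dom t)} \<le> card {b \<in> B. \<exists>b'\<in>B. inv (h \<otimes> b) \<otimes> b' \<in> E}"
        using finB by (intro card_mono) auto
      with two[OF False] \<open>0 < m\<close> show ?thesis by linarith
    qed
    then have "t \<in> \<E>'" using t(1) by (simp add: \<E>'_def)
    then show thesis by (rule that) (use t(3) in blast)
  qed
  \<comment> \<open>Once all places lie inside the domain, \<open>\<one> \<in> K\<close> makes all
    \<open>6 * m\<close> of them blocked, more than the allowance, so the alternative in
    \<open>\<E>'\<close> must be a hit.\<close>
  have hits: "\<exists>b\<in>B. shift (h \<otimes> b) p \<subseteq>\<^sub>m s"
    if s: "s \<in> \<E>'" and inside: "\<forall>b\<in>B. \<forall>v\<in>?S. h \<otimes> b \<otimes> v \<in> dom s" for s h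
  proof -
    obtain v where v: "v \<in> ?S" using p by blast
    have "blocked (h \<otimes> b) (dom s)" if "b \<in> B" for b
      unfolding blocked_def using v inside[rule_format, OF that v] K1
      by (intro bexI[of _ v] bexI[of _ "h \<otimes> b \<otimes> v"]) auto
    then have "{b \<in> B. blocked (h \<otimes> b) (dom s)} = B" by blast
    then have "\<not> card {b \<in> B. blocked (h \<otimes> b) (dom s)} \<le> 4 * m" using cardB \<open>0 < m\<close> by simp
    then show ?thesis using s unfolding \<E>'_def hit_def by blast
  qed
  have "\<E>' \<subseteq> \<E>" by (auto simp: \<E>'_def)
  then show thesis
    by (rule that[OF finB _ sys' q]) (use hits in blast)
qed

end

section \<open>Subshifts with uniform agreement\<close>

lemma closed_coordinate_eq: "closed {x :: 'i \<Rightarrow> nat. x i = c}"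
  and closed_coordinate_neq: "closed {x :: 'i \<Rightarrow> nat. x i \<noteq> c}"
proof -
  have "continuous_on UNIV (\<lambda>x :: 'i \<Rightarrow> nat. x i)" by simp
  then have "closed ((\<lambda>x :: 'i \<Rightarrow> nat. x i) -` S)" for S
    by (intro closed_vimage) (auto simp: closed_def open_discrete)
  from this[of "{c}"] this[of "- {c}"]
  show "closed {x :: 'i \<Rightarrow> nat. x i = c}" "closed {x :: 'i \<Rightarrow> nat. x i \<noteq> c}"
    by (simp_all add: vimage_def)
qed

lemma closed_coordinates_neq: "closed {x :: 'i \<Rightarrow> nat. x i \<noteq> x j}"
proof -
  have "{x :: 'i \<Rightarrow> nat. x i \<noteq> x j} = (\<Inter>c. {x. x i \<noteq> c} \<union> {x. x j \<noteq> c})" by auto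
  then show ?thesis by (simp only:) (intro closed_INT ballI closed_Un closed_coordinate_neq)
qed

lemma closed_map_le_Some: "closed {x :: 'i \<Rightarrow> nat. s \<subseteq>\<^sub>m Some \<circ> x}"
proof -
  have "{x :: 'i \<Rightarrow> nat. s \<subseteq>\<^sub>m Some \<circ> x} = (\<Inter>v\<in>dom s. {x. x v = the (s v)})"
    by (auto simp: map_le_def dom_def)
  then show ?thesis by (simp only:) (intro closed_INT ballI closed_coordinate_eq)
qed

lemma compact_bounded_configurations: "compact {x :: 'i \<Rightarrow> nat. \<forall>i. x i < k}"
proof -
  have "compactin (product_topology (\<lambda>i::'i. euclidean :: nat topology) UNIV) (\<Pi>\<^sub>E i\<in>UNIV. {..<k})"
    by (subst compactin_PiE) (auto intro: finite_imp_compact)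
  moreover have "(\<Pi>\<^sub>E i\<in>UNIV. {..<k}) = {x :: 'i \<Rightarrow> nat. \<forall>i. x i < k}" by (auto simp: PiE_iff)
  ultimately show ?thesis by (simp add: euclidean_product_topology)
qed

lemma closed_bounded_configurations: "closed {x :: 'i \<Rightarrow> nat. \<forall>i. x i < k}"
proof -
  have "{x :: 'i \<Rightarrow> nat. \<forall>i. x i < k} = (\<Inter>i. \<Union>c<k. {x. x i = c})" by auto
  then show ?thesis by (simp only:) (intro closed_INT ballI closed_UN closed_coordinate_eq; simp)
qed

context full_group
begin

section \<open>Partial 3-colourings as the initial extension system\<close>

definition partial_colourings :: "'a \<Rightarrow> ('a \<Rightarrow> nat option) set" where
  "partial_colourings g = {s. finite (dom s) \<and> ran s \<subseteq> {..<3} \<and>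
     (\<forall>h. h \<in> dom s \<longrightarrow> h \<otimes> g \<in> dom s \<longrightarrow> s h \<noteq> s (h \<otimes> g))}"

text \<open>Three colours suffice because \<open>x\<close> has only the neighbours
  \<open>x \<otimes> g\<close> and \<open>x \<otimes> inv g\<close>; there are no loops as
  \<open>g \<noteq> \<one>\<close>.\<close>

lemma partial_colouring_insert:
  assumes s: "s \<in> partial_colourings g" and g: "g \<noteq> \<one>" and x: "x \<notin> dom s"
  shows "\<exists>c. s(x \<mapsto> c) \<in> partial_colourings g"
proof -
  have "\<exists>c<3. Some c \<noteq> u \<and> Some c \<noteq> w" for u w :: "nat option"
  proof -
    have "card ({0, 1, 2} - ({the u} \<union> {the w})) \<ge> card {0, 1, 2::nat} - card ({the u} \<union> {the w})"
      by (intro diff_card_le_card_Diff) auto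
    moreover have "card ({the u} \<union> {the w}) \<le> 2"
      using card_Un_le[of "{the u}" "{the w}"] by simp
    ultimately have "{0, 1, 2} - ({the u} \<union> {the w}) \<noteq> {}" by auto
    then obtain c where "c \<in> {0, 1, 2} - ({the u} \<union> {the w})" by blast
    then show ?thesis by (intro exI[of _ c]) auto
  qed
  then obtain c where c: "c < 3" "Some c \<noteq> s (x \<otimes> g)" "Some c \<noteq> s (x \<otimes> inv g)" by blast
  have xg: "x \<otimes> g \<noteq> x" using g by simp
  have "(s(x \<mapsto> c)) h \<noteq> (s(x \<mapsto> c)) (h \<otimes> g)"
    if h: "h \<in> dom (s(x \<mapsto> c))" "h \<otimes> g \<in> dom (s(x \<mapsto> c))" for h
  proof -
    consider "h = x" | "h \<otimes> g = x" "h \<noteq> x" | "h \<noteq> x" "h \<otimes> g \<noteq> x" by blast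
    then show ?thesis
    proof cases
      case 2
      then have "h = x \<otimes> inv g" by (auto simp: m_assoc)
      with 2 c show ?thesis by auto
    next
      case 3
      with h s show ?thesis by (auto simp: partial_colourings_def)
    qed (use c xg in auto)
  qed
  moreover have "ran (s(x \<mapsto> c)) \<subseteq> {..<3}"
    using s c x by (auto simp: partial_colourings_def ran_def)
  ultimately show ?thesis
    using s unfolding partial_colourings_def by (intro exI[of _ c]) auto
qed

lemma partial_colouring_extend:
  assumes "finite A" "s \<in> partial_colourings g" "g \<noteq> \<one>"
  shows "\<exists>t\<in>partial_colourings g. dom t = dom s \<union> A \<and> s \<subseteq>\<^sub>m t"
  using assms(1)
proof induction
  case empty
  then show ?case using assms by auto
next
  case (insert x A)
  then obtain t where t: "t \<in> partial_colourings g" "dom t = dom s \<union> A" "s \<subseteq>\<^sub>m t" by blast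
  show ?case
  proof (cases "x \<in> dom t")
    case True
    then show ?thesis using t by (intro bexI[of _ t]) auto
  next
    case False
    then obtain c where c: "t(x \<mapsto> c) \<in> partial_colourings g"
      using partial_colouring_insert t assms by blast
    have "s \<subseteq>\<^sub>m t(x \<mapsto> c)" using t(2,3) False by (auto simp: map_le_def)
    moreover have "dom (t(x \<mapsto> c)) = dom s \<union> insert x A" using t(2) by simp
    ultimately show ?thesis using c by blast
  qed
qed

text \<open>Distance in the sense of \<open>K\<close> excludes both overlaps and edges between
  different patterns, so their union is proper. Greedy completion colours exactly the requested
  points, whence \<open>D = {\<one>}\<close>.\<close>

lemma extension_system_partial_colourings:
  assumes g: "g \<noteq> \<one>"
  shows "extension_system (partial_colourings g) {\<one>, g, inv g} {\<one>}"
  unfolding extension_system_def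
proof (intro conjI ballI allI impI)
  show "shift h s \<in> partial_colourings g" if s: "s \<in> partial_colourings g" for h s
  proof -
    have "ran (shift h s) \<subseteq> ran s" by (auto simp: ran_def shift_def)
    moreover have "finite (dom (shift h s))" using s by (simp add: dom_shift partial_colourings_def)
    moreover have "shift h s x \<noteq> shift h s (x \<otimes> g)" if "x \<in> dom (shift h s)" "x \<otimes> g \<in> dom (shift h s)" for x
      using that s unfolding partial_colourings_def shift_def dom_def by (auto simp flip: m_assoc)
    ultimately show ?thesis using s unfolding partial_colourings_def by blast
  qed
  fix \<F> F
  assume "finite \<F> \<and> \<F> \<subseteq> partial_colourings g \<and> pairwise (far {\<one>, g, inv g}) \<F> \<and> finite F \<and> (\<Union>s\<in>\<F>. dom s) \<subseteq> F"
  then have \<F>: "finite \<F>" "\<F> \<subseteq> partial_colourings g" "pairwise (far {\<one>, g, inv g}) \<F>"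
    and F: "finite F" "(\<Union>s\<in>\<F>. dom s) \<subseteq> F" by blast+
  define u where "u x = (if \<exists>s\<in>\<F>. x \<in> dom s then (SOME s. s \<in> \<F> \<and> x \<in> dom s) x else None)" for x
  have apart: "s = t" if "s \<in> \<F>" "t \<in> \<F>" "x \<in> dom s" "y \<in> dom t" "inv x \<otimes> y \<in> {\<one>, g}" for s t x y
  proof (rule ccontr)
    assume "s \<noteq> t"
    then have "far {\<one>, g, inv g} s t" using \<F>(3) that by (auto simp: pairwise_def)
    with that show False unfolding far_def by blast
  qed
  have u: "u x = s x" if "s \<in> \<F>" "x \<in> dom s" for s x
  proof -
    have "(SOME s. s \<in> \<F> \<and> x \<in> dom s) = s"
    proof (rule some_equality)
      show "t = s" if "t \<in> \<F> \<and> x \<in> dom t" for t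
        using that \<open>s \<in> \<F>\<close> \<open>x \<in> dom s\<close> by (intro apart[of t s x x]) auto
    qed (use that in blast)
    then show ?thesis using that unfolding u_def by auto
  qed
  have domu: "dom u = (\<Union>s\<in>\<F>. dom s)"
  proof
    show "dom u \<subseteq> (\<Union>s\<in>\<F>. dom s)" unfolding u_def dom_def by (auto split: if_splits)
    show "(\<Union>s\<in>\<F>. dom s) \<subseteq> dom u" using u by (metis UN_least domIff subsetI)
  qed
  have "u h \<noteq> u (h \<otimes> g)" if h: "h \<in> dom u" "h \<otimes> g \<in> dom u" for h
  proof -
    obtain s t where st: "s \<in> \<F>" "t \<in> \<F>" "h \<in> dom s" "h \<otimes> g \<in> dom t" using h unfolding domu by blast
    then have "s = t" by (intro apart) auto
    with st \<F>(2) have "s h \<noteq> s (h \<otimes> g)" unfolding partial_colourings_def by blast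
    with st u \<open>s = t\<close> show ?thesis by metis
  qed
  moreover have "ran u \<subseteq> {..<3}"
  proof
    fix c assume "c \<in> ran u"
    then obtain x where x: "u x = Some c" by (auto simp: ran_def)
    then have "x \<in> dom u" by blast
    then obtain s where "s \<in> \<F>" "x \<in> dom s" unfolding domu by blast
    with u x have "c \<in> ran s" by (metis ranI)
    with \<open>s \<in> \<F>\<close> \<F>(2) show "c \<in> {..<3}" unfolding partial_colourings_def by blast
  qed
  moreover have "finite (dom u)" unfolding domu using F finite_subset by blast
  ultimately have "u \<in> partial_colourings g" unfolding partial_colourings_def by blast
  then obtain t where t: "t \<in> partial_colourings g" "dom t = dom u \<union> F" "u \<subseteq>\<^sub>m t"
    using partial_colouring_extend[OF F(1) _ g] by blast
  have "s \<subseteq>\<^sub>m t" if "s \<in> \<F>" for s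
    using that u t(3) domu unfolding map_le_def by (metis UN_I)
  moreover have "dom t = F" using t(2) F(2) domu by auto
  moreover have "F <#> {\<one>} = F" by (auto simp: set_mult_def)
  ultimately show "\<exists>t\<in>partial_colourings g. F \<subseteq> dom t \<and> dom t \<subseteq> F <#> {\<one>} \<and> (\<forall>s\<in>\<F>. s \<subseteq>\<^sub>m t)"
    using t(1) by (intro bexI[of _ t]) simp_all
qed (auto simp: partial_colourings_def)

end

context full_icc_group
begin

text \<open>Each step passes to a smaller system enforcing occurrences of \<open>P n\<close>,
  together with a pattern carrying \<open>P n\<close> on \<open>B n\<close>;
  \<open>P (Suc n)\<close> enlarges that pattern to cover the next window. The last clause speaks of
  finitely many levels only, since the nested systems need not share a member; compactness passes to
  all levels later.\<close>

lemma pattern_chain: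
  assumes sys: "extension_system \<E> K D" and F: "\<And>n. finite (F n)" "\<And>n. F n \<noteq> {}"
  obtains P :: "nat \<Rightarrow> 'a \<Rightarrow> 'c option" and B where "\<forall>n. finite (B n)" "\<forall>n. F n \<subseteq> dom (P n)"
    "\<forall>n. \<forall>b\<in>B n. shift b (P n) \<subseteq>\<^sub>m P (Suc n)"
    "\<forall>N A. finite A \<longrightarrow> (\<exists>s\<in>\<E>. A \<subseteq> dom s \<and> (\<forall>n<N. \<forall>h\<in>A. \<exists>b\<in>B n. shift (h \<otimes> b) (P n) \<subseteq>\<^sub>m s))"
proof -
  define Inv where "Inv = (\<lambda>(\<E>' :: ('a \<Rightarrow> 'c option) set, p). (\<exists>K D. extension_system \<E>' K D) \<and> p \<in> \<E>' \<and> \<E>' \<subseteq> \<E>)"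
  \<comment> \<open>The state records only the system and its distinguished pattern. The
    \<open>p\<close> and \<open>B\<close> of each transition are hidden in the relation and
    recovered by choice as \<open>P\<close> and \<open>B\<close>.\<close>
  define Step where "Step n = (\<lambda>(\<E>\<^sub>1 :: ('a \<Rightarrow> 'c option) set, p\<^sub>1) (\<E>\<^sub>2, p\<^sub>2). \<E>\<^sub>2 \<subseteq> \<E>\<^sub>1 \<and> (\<exists>p B. finite (dom p) \<and> F n \<subseteq> dom p \<and> p\<^sub>1 \<subseteq>\<^sub>m p \<and> finite B \<and>
      (\<forall>b\<in>B. shift b p \<subseteq>\<^sub>m p\<^sub>2) \<and>
      (\<forall>s\<in>\<E>\<^sub>2. \<forall>h. (\<forall>b\<in>B. \<forall>v\<in>dom p. h \<otimes> b \<otimes> v \<in> dom s) \<longrightarrow> (\<exists>b\<in>B. shift (h \<otimes> b) p \<subseteq>\<^sub>m s))))"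
    for n
  have init: "\<exists>x. Inv x"
  proof -
    obtain t where "t \<in> \<E>" using extension_system_extend[OF sys, of "{}" "{}"] by auto
    then show ?thesis unfolding Inv_def using sys by (intro exI[of _ "(\<E>, t)"]) auto
  qed
  have next_step: "\<exists>y. Inv y \<and> Step n x y" if "Inv x" for n x
  proof -
    obtain \<E>\<^sub>1 p\<^sub>1 where x: "x = (\<E>\<^sub>1, p\<^sub>1)" by (cases x)
    obtain K\<^sub>1 D\<^sub>1 where sys1: "extension_system \<E>\<^sub>1 K\<^sub>1 D\<^sub>1" and p1: "p\<^sub>1 \<in> \<E>\<^sub>1" "\<E>\<^sub>1 \<subseteq> \<E>"
      using \<open>Inv x\<close> unfolding x Inv_def by auto
    have fp1: "finite (dom p\<^sub>1)" using extension_systemD(5)[OF sys1 p1(1)] .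
    then obtain p where p: "p \<in> \<E>\<^sub>1" "F n \<union> dom p\<^sub>1 \<subseteq> dom p" "p\<^sub>1 \<subseteq>\<^sub>m p"
      using extension_system_extend[OF sys1, of "{p\<^sub>1}" "F n \<union> dom p\<^sub>1"] p1 F by (auto simp: pairwise_def)
    have "dom p \<noteq> {}" using p(2) F(2)[of n] by auto
    obtain B \<E>\<^sub>2 K\<^sub>2 D\<^sub>2 q where step: "finite B" "\<E>\<^sub>2 \<subseteq> \<E>\<^sub>1" "extension_system \<E>\<^sub>2 K\<^sub>2 D\<^sub>2" "q \<in> \<E>\<^sub>2"
      "\<forall>b\<in>B. shift b p \<subseteq>\<^sub>m q"
      "\<forall>s\<in>\<E>\<^sub>2. \<forall>h. (\<forall>b\<in>B. \<forall>v\<in>dom p. h \<otimes> b \<otimes> v \<in> dom s) \<longrightarrow> (\<exists>b\<in>B. shift (h \<otimes> b) p \<subseteq>\<^sub>m s)"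
      by (rule extension_system_step[OF sys1 p(1) \<open>dom p \<noteq> {}\<close>])
    have "Inv (\<E>\<^sub>2, q)" unfolding Inv_def using step p1 by auto
    moreover have "Step n x (\<E>\<^sub>2, q)"
      unfolding x Step_def prod.case
    proof (intro conjI exI[of _ p] exI[of _ B])
      show "finite (dom p)" using extension_systemD(5)[OF sys1 p(1)] .
    qed (use step p in \<open>blast+\<close>)
    ultimately show ?thesis by blast
  qed
  obtain f where f: "\<And>n. Inv (f n)" "\<And>n. Step n (f n) (f (Suc n))"
    using dependent_nat_choice[of "\<lambda>_. Inv" Step, OF init next_step] by blast
  define Es where "Es n = fst (f n)" for n
  define ps where "ps n = snd (f n)" for n
  have sysn: "\<exists>K D. extension_system (Es n) K D" and EsE: "Es n \<subseteq> \<E>" for n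
    using f(1)[of n] unfolding Inv_def Es_def by (auto simp: case_prod_unfold)
  have "\<exists>p B. finite (dom p) \<and> F n \<subseteq> dom p \<and> ps n \<subseteq>\<^sub>m p \<and> finite B \<and> (\<forall>b\<in>B. shift b p \<subseteq>\<^sub>m ps (Suc n)) \<and>
      (\<forall>s\<in>Es (Suc n). \<forall>h. (\<forall>b\<in>B. \<forall>v\<in>dom p. h \<otimes> b \<otimes> v \<in> dom s) \<longrightarrow> (\<exists>b\<in>B. shift (h \<otimes> b) p \<subseteq>\<^sub>m s))" for n
    using f(2)[of n] unfolding Step_def Es_def ps_def case_prod_unfold by (elim conjE)
  then obtain P B where PB: "\<And>n. finite (dom (P n)) \<and> F n \<subseteq> dom (P n) \<and> ps n \<subseteq>\<^sub>m P n \<and> finite (B n) \<and>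
      (\<forall>b\<in>B n. shift b (P n) \<subseteq>\<^sub>m ps (Suc n)) \<and>
      (\<forall>s\<in>Es (Suc n). \<forall>h. (\<forall>b\<in>B n. \<forall>v\<in>dom (P n). h \<otimes> b \<otimes> v \<in> dom s) \<longrightarrow> (\<exists>b\<in>B n. shift (h \<otimes> b) (P n) \<subseteq>\<^sub>m s))"
    by metis
  have "Es (Suc n) \<subseteq> Es n" for n
    using f(2)[of n] unfolding Step_def Es_def case_prod_unfold by (elim conjE)
  then have anti: "Es m \<subseteq> Es n" if "n \<le> m" for m n
    using lift_Suc_antimono_le[of Es n m] that by blast
  show thesis
  proof (rule that[of B P])
    show "\<forall>n. finite (B n)" "\<forall>n. F n \<subseteq> dom (P n)" using PB by blast+
    show "\<forall>n. \<forall>b\<in>B n. shift b (P n) \<subseteq>\<^sub>m P (Suc n)" using PB map_le_trans by blast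
    show "\<forall>N A. finite A \<longrightarrow> (\<exists>s\<in>\<E>. A \<subseteq> dom s \<and> (\<forall>n<N. \<forall>h\<in>A. \<exists>b\<in>B n. shift (h \<otimes> b) (P n) \<subseteq>\<^sub>m s))"
    proof (intro allI impI)
      fix N and A :: "'a set" assume "finite A"
      \<comment> \<open>All potential places of the required occurrences are put inside the domain,
        so that the rule of every level below \<open>N\<close> applies to a single
        \<open>s \<in> Es N\<close>.\<close>
      define A' where "A' = A \<union> (\<Union>n<N. (\<lambda>(h, b, v). h \<otimes> b \<otimes> v) ` (A \<times> B n \<times> dom (P n)))"
      have "finite A'" unfolding A'_def using \<open>finite A\<close> PB by simp
      obtain K D where "extension_system (Es N) K D" using sysn by blast
      from extension_system_extend[OF this, of "{}" A'] \<open>finite A'\<close>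
      obtain s where s: "s \<in> Es N" "A' \<subseteq> dom s" by auto
      have "\<exists>b\<in>B n. shift (h \<otimes> b) (P n) \<subseteq>\<^sub>m s" if "n < N" "h \<in> A" for n h
      proof -
        have "h \<otimes> b \<otimes> v \<in> dom s" if "b \<in> B n" "v \<in> dom (P n)" for b v
        proof -
          have "h \<otimes> b \<otimes> v \<in> A'" unfolding A'_def using that \<open>n < N\<close> \<open>h \<in> A\<close>
            by (intro UnI2 UN_I[of n] image_eqI[where x = "(h, b, v)"]) auto
          with s show ?thesis by blast
        qed
        moreover have "s \<in> Es (Suc n)" using anti[of "Suc n" N] s that by auto
        ultimately show ?thesis using PB[of n] by blast
      qed
      moreover have "A \<subseteq> dom s" using s by (auto simp: A'_def)
      ultimately show "\<exists>s\<in>\<E>. A \<subseteq> dom s \<and> (\<forall>n<N. \<forall>h\<in>A. \<exists>b\<in>B n. shift (h \<otimes> b) (P n) \<subseteq>\<^sub>m s)"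
        using s EsE by blast
    qed
  qed
qed

text \<open>\<open>T\<close> precedes \<open>x\<close> and \<open>y\<close>: this uniformity carries
  the argument for products. Only the given \<open>g\<close> is claimed to move every point.\<close>

lemma subshift_exists:
  fixes F :: "nat \<Rightarrow> 'a set"
  assumes g: "g \<noteq> \<one>" and F: "\<And>n. finite (F n)" "\<And>n. F n \<noteq> {}"
  shows "\<exists>X :: ('a \<Rightarrow> nat) set. closed X \<and> X \<noteq> {} \<and> (\<forall>x\<in>X. \<forall>h. x h < 3) \<and> (\<forall>x\<in>X. \<forall>k. shift k x \<in> X) \<and>
    (\<forall>x\<in>X. shift g x \<noteq> x) \<and>
    (\<forall>n. \<exists>T. finite T \<and> (\<forall>x\<in>X. \<forall>y\<in>X. \<exists>t\<in>T. \<forall>v\<in>F n. x (t \<otimes> v) = y (t \<otimes> v)))"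
proof -
  obtain P :: "nat \<Rightarrow> 'a \<Rightarrow> nat option" and B where finB: "\<forall>n. finite (B n)" and FP: "\<forall>n. F n \<subseteq> dom (P n)"
    and chain: "\<forall>n. \<forall>b\<in>B n. shift b (P n) \<subseteq>\<^sub>m P (Suc n)"
    and ex: "\<forall>N A. finite A \<longrightarrow> (\<exists>s\<in>partial_colourings g. A \<subseteq> dom s \<and> (\<forall>n<N. \<forall>h\<in>A. \<exists>b\<in>B n. shift (h \<otimes> b) (P n) \<subseteq>\<^sub>m s))"
    by (rule pattern_chain[OF extension_system_partial_colourings[OF g] F])
  define C where "C = (\<lambda>(n, h). {x :: 'a \<Rightarrow> nat. \<exists>b\<in>B n. shift (h \<otimes> b) (P n) \<subseteq>\<^sub>m Some \<circ> x} \<inter> {x. x h \<noteq> x (h \<otimes> g)})"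
  define X where "X = {x :: 'a \<Rightarrow> nat. \<forall>h. x h < 3} \<inter> (\<Inter>i. C i)"
  have X: "x \<in> X \<longleftrightarrow> (\<forall>h. x h < 3) \<and> (\<forall>n h. \<exists>b\<in>B n. shift (h \<otimes> b) (P n) \<subseteq>\<^sub>m Some \<circ> x) \<and> (\<forall>h. x h \<noteq> x (h \<otimes> g))" for x
    unfolding X_def C_def by auto
  have closedC: "closed (C i)" for i
  proof -
    obtain n h where i: "i = (n, h)" by (cases i)
    have "{x :: 'a \<Rightarrow> nat. \<exists>b\<in>B n. shift (h \<otimes> b) (P n) \<subseteq>\<^sub>m Some \<circ> x} =
        (\<Union>b\<in>B n. {x. shift (h \<otimes> b) (P n) \<subseteq>\<^sub>m Some \<circ> x})" by blast
    moreover have "closed \<dots>" using finB by (intro closed_UN ballI closed_map_le_Some) blast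
    ultimately show ?thesis unfolding i C_def prod.case
      by (intro closed_Int closed_coordinates_neq) simp
  qed
  have comp: "compact {x :: 'a \<Rightarrow> nat. \<forall>h. x h < 3}" by (rule compact_bounded_configurations)
  have "X \<noteq> {}"
    unfolding X_def
  proof (rule compact_imp_fip_image[OF comp])
    show "closed (C i)" for i by (rule closedC)
    fix I' :: "(nat \<times> 'a) set" assume I': "finite I'"
    define N where "N = Suc (Max (insert 0 (fst ` I')))"
    define A where "A = snd ` I' \<union> (\<lambda>h. h \<otimes> g) ` snd ` I'"
    have "finite A" using I' by (simp add: A_def)
    with ex obtain s where s: "s \<in> partial_colourings g" "A \<subseteq> dom s"
      "\<forall>n<N. \<forall>h\<in>A. \<exists>b\<in>B n. shift (h \<otimes> b) (P n) \<subseteq>\<^sub>m s"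
      by blast
    \<comment> \<open>The default 0 is a legal colour; the finitely many constraints in question are
      decided inside \<open>dom s\<close>.\<close>
    define x where "x v = (case s v of None \<Rightarrow> 0 | Some c \<Rightarrow> c)" for v
    have sx: "s \<subseteq>\<^sub>m Some \<circ> x" by (auto simp: map_le_def x_def)
    have "x h < 3" for h
    proof (cases "s h")
      case (Some c)
      then have "c \<in> ran s" by (rule ranI)
      with s(1) Some show ?thesis by (auto simp: partial_colourings_def x_def)
    qed (simp add: x_def)
    moreover have "x \<in> C i" if "i \<in> I'" for i
    proof -
      obtain n h where i: "i = (n, h)" by (cases i)
      have "n \<in> insert 0 (fst ` I')" using that i by force
      then have "n < N" unfolding N_def using I' by (simp add: less_Suc_eq_le)
      have h: "h \<in> A" "h \<otimes> g \<in> A" using that i unfolding A_def by force+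
      then have "h \<in> dom s" "h \<otimes> g \<in> dom s" using s(2) by blast+
      moreover from this have "s h \<noteq> s (h \<otimes> g)" using s(1) unfolding partial_colourings_def by blast
      ultimately have "x h \<noteq> x (h \<otimes> g)" by (auto simp: x_def)
      moreover have "\<exists>b\<in>B n. shift (h \<otimes> b) (P n) \<subseteq>\<^sub>m Some \<circ> x"
        using s(3) \<open>n < N\<close> h(1) sx map_le_trans by blast
      ultimately show ?thesis unfolding i C_def by blast
    qed
    ultimately show "{x. \<forall>h. x h < 3} \<inter> (\<Inter>i\<in>I'. C i) \<noteq> {}" by blast
  qed
  moreover have "closed X"
    unfolding X_def using closedC by (intro closed_Int closed_bounded_configurations closed_INT) auto
  moreover have "shift k x \<in> X" if x: "x \<in> X" for x k
  proof -
    have "\<exists>b\<in>B n. shift (h \<otimes> b) (P n) \<subseteq>\<^sub>m Some \<circ> shift k x" for n h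
    proof -
      obtain b where b: "b \<in> B n" "shift (inv k \<otimes> h \<otimes> b) (P n) \<subseteq>\<^sub>m Some \<circ> x" using x unfolding X by blast
      have "shift k (Some \<circ> x) = Some \<circ> shift k x" by (auto simp: shift_def)
      with shift_map_le[OF b(2), of k] b(1) show ?thesis by (auto simp: shift_shift m_assoc)
    qed
    moreover have "shift k x h \<noteq> shift k x (h \<otimes> g)" for h
      using x unfolding X by (auto simp: shift_def simp flip: m_assoc)
    ultimately show ?thesis using x unfolding X by (auto simp: shift_def)
  qed
  moreover have "shift g x \<noteq> x" if x: "x \<in> X" for x
  proof
    assume "shift g x = x"
    then have "x \<one> = x g" by (metis shift_def carrier_UNIV UNIV_I l_inv)
    moreover have "x \<one> \<noteq> x (\<one> \<otimes> g)" using x unfolding X by blast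
    ultimately show False by simp
  qed
  moreover have "\<exists>T. finite T \<and> (\<forall>x\<in>X. \<forall>y\<in>X. \<exists>t\<in>T. \<forall>v\<in>F n. x (t \<otimes> v) = y (t \<otimes> v))" for n
  proof (intro exI[of _ "(\<lambda>(u, b). u \<otimes> b) ` (B (Suc n) \<times> B n)"] conjI ballI)
    show "finite ((\<lambda>(u, b). u \<otimes> b) ` (B (Suc n) \<times> B n))" using finB by blast
    fix x y assume "x \<in> X" "y \<in> X"
    then obtain u where u: "u \<in> B (Suc n)" "shift (\<one> \<otimes> u) (P (Suc n)) \<subseteq>\<^sub>m Some \<circ> x"
      unfolding X by blast
    obtain b where b: "b \<in> B n" "shift (u \<otimes> b) (P n) \<subseteq>\<^sub>m Some \<circ> y"
      using \<open>y \<in> X\<close> unfolding X by blast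
    have "shift u (shift b (P n)) \<subseteq>\<^sub>m shift u (P (Suc n))" using chain b(1) by (intro shift_map_le) blast
    with u(2) have xb: "shift (u \<otimes> b) (P n) \<subseteq>\<^sub>m Some \<circ> x" by (simp add: shift_shift) (rule map_le_trans)
    have "x (u \<otimes> b \<otimes> v) = y (u \<otimes> b \<otimes> v)" if "v \<in> F n" for v
    proof -
      have "u \<otimes> b \<otimes> v \<in> dom (shift (u \<otimes> b) (P n))" using FP that unfolding dom_shift by blast
      with xb b(2) have "Some (x (u \<otimes> b \<otimes> v)) = Some (y (u \<otimes> b \<otimes> v))"
        unfolding map_le_def by (metis comp_apply)
      then show ?thesis by simp
    qed
    moreover have "u \<otimes> b \<in> (\<lambda>(u, b). u \<otimes> b) ` (B (Suc n) \<times> B n)" using u b by force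
    ultimately show "\<exists>t\<in>(\<lambda>(u, b). u \<otimes> b) ` (B (Suc n) \<times> B n). \<forall>v\<in>F n. x (t \<otimes> v) = y (t \<otimes> v)" by blast
  qed
  moreover have "\<forall>x\<in>X. \<forall>h. x h < 3" by (simp add: X)
  ultimately show ?thesis by (intro exI[of _ X]) blast
qed

end

section \<open>The flow\<close>

lemma limit_function_iff:
  fixes f :: "'b \<Rightarrow> 'i \<Rightarrow> 'c::topological_space"
  shows "(f \<longlongrightarrow> l) F \<longleftrightarrow> (\<forall>i. ((\<lambda>x. f x i) \<longlongrightarrow> l i) F)"
  using limitin_componentwise[of "\<lambda>_. euclidean" UNIV f l F]
  by (simp add: euclidean_product_topology)

text \<open>Row \<open>g\<close> of a configuration lies in a subshift on which \<open>g\<close> has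
  no fixed point, so a point fixed by \<open>g\<close> would have a fixed row. As the group lives on
  \<open>nat\<close>, initial segments serve both as windows and as finite sets of rows.\<close>

lemma group_flow_nat:
  fixes H :: "(nat, 'm) monoid_scheme"
  assumes "full_icc_group H"
  shows "\<exists>(X :: (nat \<times> nat \<Rightarrow> nat) topology) a.
    group_flow H X a \<and> free_flow H X a \<and> metrizable_space X \<and> proximal_flow H X a"
proof -
  interpret H: full_icc_group H by fact
  let ?good = "\<lambda>W :: (nat \<Rightarrow> nat) set. closed W \<and> W \<noteq> {} \<and> (\<forall>x\<in>W. \<forall>h. x h < 3) \<and> (\<forall>x\<in>W. \<forall>k. H.shift k x \<in> W) \<and>
    (\<forall>n. \<exists>T. finite T \<and> (\<forall>x\<in>W. \<forall>y\<in>W. \<exists>t\<in>T. \<forall>v\<le>n. x (t \<otimes>\<^bsub>H\<^esub> v) = y (t \<otimes>\<^bsub>H\<^esub> v)))"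
  have ex: "\<exists>W. ?good W \<and> (g \<noteq> \<one>\<^bsub>H\<^esub> \<longrightarrow> (\<forall>x\<in>W. H.shift g x \<noteq> x))" for g
  proof (cases "g = \<one>\<^bsub>H\<^esub>")
    case True
    \<comment> \<open>The row of the identity carries no freeness demand, and one constant
      configuration fills it.\<close>
    have "{\<lambda>_. 0} = (\<Inter>h. {x :: nat \<Rightarrow> nat. x h = 0})" by auto
    then have "closed {\<lambda>_ :: nat. 0 :: nat}"
      by (simp only:) (intro closed_INT ballI closed_coordinate_eq)
    then show ?thesis using True
      by (intro exI[of _ "{\<lambda>_. 0}"]) (auto simp: H.shift_def intro!: exI[of _ "{0}"])
  next
    case False
    from H.subshift_exists[OF False, of "\<lambda>n. {..n}"] show ?thesis
      by (auto simp: Ball_def)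
  qed
  have "\<exists>W. \<forall>g. ?good (W g) \<and> (g \<noteq> \<one>\<^bsub>H\<^esub> \<longrightarrow> (\<forall>x\<in>W g. H.shift g x \<noteq> x))"
    by (intro choice allI ex)
  then obtain W where W': "\<forall>g. ?good (W g) \<and> (g \<noteq> \<one>\<^bsub>H\<^esub> \<longrightarrow> (\<forall>x\<in>W g. H.shift g x \<noteq> x))"
    by (elim exE) (rule that)
  have W: "?good (W g)" for g using spec[OF W'] by (rule conjunct1)
  have Wclosed: "closed (W g)" and Wne: "W g \<noteq> {}" and W3: "\<forall>x\<in>W g. \<forall>h. x h < 3"
    and Wshift: "\<forall>x\<in>W g. \<forall>k. H.shift k x \<in> W g"
    and Wagree: "\<forall>n. \<exists>T. finite T \<and> (\<forall>x\<in>W g. \<forall>y\<in>W g. \<exists>t\<in>T. \<forall>v\<le>n. x (t \<otimes>\<^bsub>H\<^esub> v) = y (t \<otimes>\<^bsub>H\<^esub> v))" for g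
    using W[of g] by - (elim conjE, assumption)+
  have free: "H.shift g x \<noteq> x" if "g \<noteq> \<one>\<^bsub>H\<^esub>" "x \<in> W g" for g x
    using conjunct2[OF spec[OF W', of g]] that by blast
  define Z where "Z = {z :: nat \<times> nat \<Rightarrow> nat. \<forall>g. (\<lambda>h. z (g, h)) \<in> W g}"
  define act where "act k z = (\<lambda>(g, h). z (g, inv\<^bsub>H\<^esub> k \<otimes>\<^bsub>H\<^esub> h))" for k and z :: "nat \<times> nat \<Rightarrow> nat"
  have act_row: "(\<lambda>h. act k z (g, h)) = H.shift k (\<lambda>h. z (g, h))" for k z g
    by (simp add: act_def H.shift_def)
  have actZ: "act k z \<in> Z" if "z \<in> Z" for k z
    using that Wshift unfolding Z_def by (simp add: act_row)
  have act_act: "act k (act l z) = act (k \<otimes>\<^bsub>H\<^esub> l) z" for k l z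
    by (auto simp: act_def H.inv_mult_group H.m_assoc)
  have act_one: "act \<one>\<^bsub>H\<^esub> z = z" for z by (auto simp: act_def)
  have cont: "continuous_on A (act k)" for A k
    by (rule continuous_on_coordinatewise_then_product)
      (auto simp: act_def case_prod_unfold intro!: continuous_on_subset[OF continuous_on_product_coordinates])
  have "closed Z"
  proof -
    have "Z = (\<Inter>g. (\<lambda>z h. z (g, h)) -` W g)" unfolding Z_def by auto
    moreover have "closed ((\<lambda>z h. z (g, h)) -` W g)" for g
      by (intro closed_vimage Wclosed continuous_on_coordinatewise_then_product continuous_on_product_coordinates)
    ultimately show ?thesis by (simp only:) (intro closed_INT ballI)
  qed
  moreover have "Z \<subseteq> {z. \<forall>i. z i < 3}"
  proof
    fix z assume z: "z \<in> Z"
    have "z (g, h) < 3" for g h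
    proof -
      have "(\<lambda>h. z (g, h)) \<in> W g" using z by (simp add: Z_def)
      from bspec[OF W3 this] show ?thesis by simp
    qed
    then show "z \<in> {z. \<forall>i. z i < 3}" by auto
  qed
  ultimately have compZ: "compact Z"
    using closed_Int_compact[OF _ compact_bounded_configurations[of 3]] by (metis inf.absorb1)
  have "Z \<noteq> {}"
  proof -
    have "(\<lambda>(g, h). (SOME x. x \<in> W g) h) \<in> Z" using Wne by (simp add: Z_def some_in_eq)
    then show ?thesis by blast
  qed
  \<comment> \<open>Rows are aligned one after another. First \<open>s\<close> aligns row
    \<open>j\<close> on a window containing all products of \<open>T\<close> with
    \<open>{..n}\<close>; then some \<open>t \<in> T\<close> aligns the other rows of the pair moved
    by \<open>inv s\<close>, and \<open>s \<otimes> t\<close> serves all rows. The window is fixed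
    before \<open>s\<close> is known, so \<open>T\<close> must serve every pair.\<close>
  have agree: "\<exists>T. finite T \<and> (\<forall>x\<in>Z. \<forall>y\<in>Z. \<exists>t\<in>T. \<forall>g\<in>A. \<forall>h\<le>n. x (g, t \<otimes>\<^bsub>H\<^esub> h) = y (g, t \<otimes>\<^bsub>H\<^esub> h))"
    if "finite A" for A n
    using that
  proof (induction A)
    case empty
    then show ?case by (intro exI[of _ "{0}"]) auto
  next
    case (insert j A)
    then obtain T where T: "finite T"
      "\<And>x y. x \<in> Z \<Longrightarrow> y \<in> Z \<Longrightarrow> \<exists>t\<in>T. \<forall>g\<in>A. \<forall>h\<le>n. x (g, t \<otimes>\<^bsub>H\<^esub> h) = y (g, t \<otimes>\<^bsub>H\<^esub> h)" by blast
    define n' where "n' = Max ((\<lambda>(t, h). t \<otimes>\<^bsub>H\<^esub> h) ` (T \<times> {..n}))"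
    have n': "t \<otimes>\<^bsub>H\<^esub> h \<le> n'" if "t \<in> T" "h \<le> n" for t h
      unfolding n'_def using T(1) that by (intro Max_ge) force+
    obtain T' where T': "finite T'"
      "\<And>x y. x \<in> W j \<Longrightarrow> y \<in> W j \<Longrightarrow> \<exists>t\<in>T'. \<forall>v\<le>n'. x (t \<otimes>\<^bsub>H\<^esub> v) = y (t \<otimes>\<^bsub>H\<^esub> v)" 
      using Wagree[of j] by metis
    have "\<exists>t\<in>(\<lambda>(s, t). s \<otimes>\<^bsub>H\<^esub> t) ` (T' \<times> T). \<forall>g\<in>insert j A. \<forall>h\<le>n. x (g, t \<otimes>\<^bsub>H\<^esub> h) = y (g, t \<otimes>\<^bsub>H\<^esub> h)"
      if xy: "x \<in> Z" "y \<in> Z" for x y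
    proof -
      obtain s where s: "s \<in> T'" "\<And>v. v \<le> n' \<Longrightarrow> x (j, s \<otimes>\<^bsub>H\<^esub> v) = y (j, s \<otimes>\<^bsub>H\<^esub> v)"
        using T'(2)[of "\<lambda>h. x (j, h)" "\<lambda>h. y (j, h)"] xy unfolding Z_def by blast
      obtain t where t: "t \<in> T" "\<And>g h. g \<in> A \<Longrightarrow> h \<le> n \<Longrightarrow>
          act (inv\<^bsub>H\<^esub> s) x (g, t \<otimes>\<^bsub>H\<^esub> h) = act (inv\<^bsub>H\<^esub> s) y (g, t \<otimes>\<^bsub>H\<^esub> h)"
        using T(2)[OF actZ[OF xy(1)] actZ[OF xy(2)], of "inv\<^bsub>H\<^esub> s" "inv\<^bsub>H\<^esub> s"] by blast
      have "x (g, s \<otimes>\<^bsub>H\<^esub> t \<otimes>\<^bsub>H\<^esub> h) = y (g, s \<otimes>\<^bsub>H\<^esub> t \<otimes>\<^bsub>H\<^esub> h)" if "g \<in> insert j A" "h \<le> n" for g h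
      proof (cases "g = j")
        case True
        then show ?thesis using s(2)[OF n'[OF t(1) that(2)]] by (simp add: H.m_assoc)
      next
        case False
        then show ?thesis using t(2)[of g h] that by (simp add: act_def H.m_assoc)
      qed
      moreover have "s \<otimes>\<^bsub>H\<^esub> t \<in> (\<lambda>(s, t). s \<otimes>\<^bsub>H\<^esub> t) ` (T' \<times> T)" using s t by force
      ultimately show ?thesis by blast
    qed
    moreover have "finite ((\<lambda>(s, t). s \<otimes>\<^bsub>H\<^esub> t) ` (T' \<times> T))" using T T' by simp
    ultimately show ?case by blast
  qed
  let ?X = "top_of_set Z"
  have "metrizable_space (euclidean :: nat topology)"
  proof -
    have "discrete_topology (UNIV :: nat set) = euclidean"
      by (simp add: discrete_topology_unique open_discrete)
    then show ?thesis by (metis metrizable_space_discrete_topology)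
  qed
  then have "metrizable_space (euclidean :: (nat \<times> nat \<Rightarrow> nat) topology)"
    unfolding euclidean_product_topology[symmetric] metrizable_space_product_topology by simp
  then have "metrizable_space ?X" by (rule metrizable_space_subtopology)
  moreover from this have "Hausdorff_space ?X" by (rule metrizable_imp_Hausdorff_space)
  then have "group_flow H ?X act"
    unfolding group_flow_def
  proof (intro conjI ballI)
    fix k
    have "homeomorphic_maps ?X ?X (act k) (act (inv\<^bsub>H\<^esub> k))"
      unfolding homeomorphic_maps_def
      using cont actZ by (auto simp: act_act act_one)
    then show "homeomorphic_map ?X ?X (act k)" by (rule homeomorphic_maps_imp_map)
  qed (use H.is_group \<open>Z \<noteq> {}\<close> compZ in \<open>auto simp: act_act act_one compact_space_subtopology\<close>)
  moreover have "free_flow H ?X act"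
    unfolding free_flow_def
  proof (intro ballI equalityI subsetI)
    fix z g assume z: "z \<in> topspace ?X" and g: "g \<in> {g \<in> carrier H. act g z = z}"
    show "g \<in> {\<one>\<^bsub>H\<^esub>}"
    proof (rule ccontr)
      assume "g \<notin> {\<one>\<^bsub>H\<^esub>}"
      then have "H.shift g (\<lambda>h. z (g, h)) \<noteq> (\<lambda>h. z (g, h))" using z by (intro free) (auto simp: Z_def)
      then show False using g act_row[of g z g] by simp
    qed
  qed (auto simp: act_one)
  moreover have "proximal_flow H ?X act"
    unfolding proximal_flow_def
  proof (intro ballI)
    fix x1 x2 assume "x1 \<in> topspace ?X" "x2 \<in> topspace ?X"
    then have x: "x1 \<in> Z" "x2 \<in> Z" by auto
    have "\<exists>t. \<forall>g\<le>n. \<forall>h\<le>n. x1 (g, t \<otimes>\<^bsub>H\<^esub> h) = x2 (g, t \<otimes>\<^bsub>H\<^esub> h)" for n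
      using agree[of "{..n}" n] x by (auto simp: Ball_def) blast
    then obtain t where t: "\<And>n g h. g \<le> n \<Longrightarrow> h \<le> n \<Longrightarrow> x1 (g, t n \<otimes>\<^bsub>H\<^esub> h) = x2 (g, t n \<otimes>\<^bsub>H\<^esub> h)"
      by metis
    define s where "s n = inv\<^bsub>H\<^esub> (t n)" for n
    \<comment> \<open>Compactness yields a limit for the first point only. The second point follows:
      at a fixed coordinate \<open>(g, h)\<close> both agree as soon as \<open>r n\<close> is at
      least \<open>max g h\<close>.\<close>
    obtain y r where y: "y \<in> Z" "strict_mono (r :: nat \<Rightarrow> nat)" "((\<lambda>n. act (s n) x1) \<circ> r) \<longlonglongrightarrow> y"
    proof (rule seq_compactE[OF compact_imp_seq_compact[OF compZ]])
      show "\<forall>n. act (s n) x1 \<in> Z" using actZ[OF x(1)] by blast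
    qed
    have "(\<lambda>n. act (s (r n)) x2) \<longlonglongrightarrow> y"
      unfolding limit_function_iff
    proof
      fix i :: "nat \<times> nat"
      obtain g h where i: "i = (g, h)" by (cases i)
      have "(\<lambda>n. act (s (r n)) x1 i) \<longlonglongrightarrow> y i"
        using y(3) unfolding limit_function_iff comp_def by blast
      moreover have "\<forall>\<^sub>F n in sequentially. act (s (r n)) x1 i = act (s (r n)) x2 i"
        using eventually_ge_at_top[of "max g h"]
      proof eventually_elim
        case (elim n)
        then have "max g h \<le> r n" using seq_suble[OF y(2), of n] by linarith
        then show ?case using t[of g "r n" h] by (simp add: i act_def s_def)
      qed
      ultimately show "(\<lambda>n. act (s (r n)) x2 i) \<longlonglongrightarrow> y i" by (rule Lim_transform_eventually)
    qed
    moreover have "(\<lambda>n. act (s (r n)) x1) \<longlonglongrightarrow> y" using y(3) by (simp add: comp_def)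
    moreover have "limitin ?X (\<lambda>g. act g x) y (filtermap (\<lambda>n. s (r n)) sequentially)"
      if "(\<lambda>n. act (s (r n)) x) \<longlonglongrightarrow> y" "x \<in> Z" for x
    proof -
      have "limitin ?X (\<lambda>n. act (s (r n)) x) y sequentially"
        using that y(1) actZ by (simp add: limitin_subtopology)
      then show ?thesis by (simp add: limitin_def eventually_filtermap)
    qed
    ultimately show "\<exists>y\<in>topspace ?X. \<exists>F. F \<noteq> bot \<and> (\<forall>\<^sub>F g in F. g \<in> carrier H) \<and>
        limitin ?X (\<lambda>g. act g x1) y F \<and> limitin ?X (\<lambda>g. act g x2) y F"
      using y(1) x
      by (intro bexI[of _ y] exI[of _ "filtermap (\<lambda>n. s (r n)) sequentially"]) (simp_all add: filtermap_bot_iff)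
  qed
  ultimately show ?thesis by blast
qed

section \<open>Transport of flows along injections of the space and isomorphisms of the
  group\<close>

lemma flow_transport_space:
  fixes f :: "'x \<Rightarrow> 'y"
  assumes flow: "group_flow G X a" "free_flow G X a" "metrizable_space X" "proximal_flow G X a"
    and inj: "inj_on f (topspace X)"
  shows "\<exists>(Y :: 'y topology) b. group_flow G Y b \<and> free_flow G Y b \<and> metrizable_space Y \<and> proximal_flow G Y b"
proof -
  define i where "i = inv_into (topspace X) f"
  \<comment> \<open>The topology is carried over by \<open>f\<close>, which becomes a homeomorphism
    onto its image. In the final application \<open>real\<close> provides just a large enough set of
    points.\<close>
  define Y where "Y = pullback_topology (f ` topspace X) i X"
  define b where "b g y = f (a g (i y))" for g y
  have i_f: "i (f x) = x" if "x \<in> topspace X" for x using inj that by (simp add: i_def)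
  have topY: "topspace Y = f ` topspace X" unfolding Y_def topspace_pullback_topology by (auto simp: i_f)
  have contf: "continuous_map X Y f"
    unfolding Y_def by (rule continuous_map_pullback') (auto intro: continuous_map_eq[OF continuous_map_id] simp: i_f)
  have conti: "continuous_map Y X i"
  proof -
    have "continuous_map Y X (id \<circ> i)" unfolding Y_def by (rule continuous_map_pullback[OF continuous_map_id])
    then show ?thesis by simp
  qed
  have maps: "homeomorphic_maps X Y f i"
    unfolding homeomorphic_maps_def using contf conti by (auto simp: topY i_f)
  then have "X homeomorphic_space Y" unfolding homeomorphic_space_def by blast
  have mapf: "homeomorphic_map X Y f" and mapi: "homeomorphic_map Y X i"
    using maps homeomorphic_maps_imp_map homeomorphic_maps_sym by blast+
  have aX: "a g x \<in> topspace X" if "g \<in> carrier G" "x \<in> topspace X" for g x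
    using flow(1) that homeomorphic_imp_surjective_map[of X X "a g"] unfolding group_flow_def by blast
  have "group_flow G Y b"
    unfolding group_flow_def
  proof (intro conjI ballI)
    show "group G" using flow(1) by (simp add: group_flow_def)
    show "topspace Y \<noteq> {}" using flow(1) by (simp add: group_flow_def topY)
    show "compact_space Y" "Hausdorff_space Y"
      using flow(1) homeomorphic_compact_space homeomorphic_Hausdorff_space \<open>X homeomorphic_space Y\<close>
      unfolding group_flow_def by blast+
    show "homeomorphic_map Y Y (b g)" if "g \<in> carrier G" for g
    proof -
      have "homeomorphic_map Y Y (f \<circ> (a g \<circ> i))"
        using flow(1) that
        by (intro homeomorphic_map_compose[OF homeomorphic_map_compose[OF mapi] mapf]) (simp add: group_flow_def)
      moreover have "f \<circ> (a g \<circ> i) = b g" by (auto simp: b_def)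
      ultimately show ?thesis by simp
    qed
    show "b \<one>\<^bsub>G\<^esub> y = y" if "y \<in> topspace Y" for y
      using that flow(1) unfolding group_flow_def by (auto simp: topY b_def i_f)
    show "b (g \<otimes>\<^bsub>G\<^esub> h) y = b g (b h y)" if "g \<in> carrier G" "h \<in> carrier G" "y \<in> topspace Y" for g h y
      using that flow(1) aX unfolding group_flow_def by (auto simp: topY b_def i_f)
  qed
  moreover have "free_flow G Y b"
    unfolding free_flow_def topY
  proof (intro ballI)
    fix y assume "y \<in> f ` topspace X"
    then obtain x where x: "x \<in> topspace X" "y = f x" by blast
    have "{g \<in> carrier G. b g y = y} = {g \<in> carrier G. a g x = x}"
      using x aX inj_onD[OF inj] by (auto simp: b_def i_f)
    then show "{g \<in> carrier G. b g y = y} = {\<one>\<^bsub>G\<^esub>}" using flow(2) x by (simp add: free_flow_def)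
  qed
  moreover have "metrizable_space Y"
    using flow(3) homeomorphic_metrizable_space \<open>X homeomorphic_space Y\<close> by blast
  moreover have "proximal_flow G Y b"
    unfolding proximal_flow_def topY
  proof (intro ballI)
    fix y1 y2 assume "y1 \<in> f ` topspace X" "y2 \<in> f ` topspace X"
    then obtain x1 x2 where x: "x1 \<in> topspace X" "x2 \<in> topspace X" "y1 = f x1" "y2 = f x2" by blast
    then obtain y F where F: "y \<in> topspace X" "F \<noteq> bot" "\<forall>\<^sub>F g in F. g \<in> carrier G"
      "limitin X (\<lambda>g. a g x1) y F" "limitin X (\<lambda>g. a g x2) y F"
      using flow(4) unfolding proximal_flow_def by blast
    have "limitin Y (\<lambda>g. b g y1) (f y) F" "limitin Y (\<lambda>g. b g y2) (f y) F"
      using continuous_map_limit[OF contf F(4)] continuous_map_limit[OF contf F(5)] x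
      by (simp_all add: b_def i_f comp_def)
    with F show "\<exists>y\<in>f ` topspace X. \<exists>F. F \<noteq> bot \<and> (\<forall>\<^sub>F g in F. g \<in> carrier G) \<and>
        limitin Y (\<lambda>g. b g y1) y F \<and> limitin Y (\<lambda>g. b g y2) y F"
      by blast
  qed
  ultimately show ?thesis by blast
qed

lemma flow_transport_group:
  assumes flow: "group_flow H X a" "free_flow H X a" "proximal_flow H X a"
    and G: "group G" and iso: "\<phi> \<in> iso G H"
  shows "group_flow G X (\<lambda>g. a (\<phi> g)) \<and> free_flow G X (\<lambda>g. a (\<phi> g)) \<and> proximal_flow G X (\<lambda>g. a (\<phi> g))"
proof (intro conjI)
  interpret G: group G by fact
  have bij: "bij_betw \<phi> (carrier G) (carrier H)" and hom: "\<phi> \<in> hom G H" using iso by (auto simp: iso_def)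
  have H: "group H" using flow(1) by (simp add: group_flow_def)
  have one: "\<phi> \<one>\<^bsub>G\<^esub> = \<one>\<^bsub>H\<^esub>" using hom_one[OF hom G H] .
  have \<phi>H: "\<phi> g \<in> carrier H" if "g \<in> carrier G" for g using that bij by (auto simp: bij_betw_def)
  show "group_flow G X (\<lambda>g. a (\<phi> g))"
    using flow(1) G hom one \<phi>H unfolding group_flow_def by (auto simp: hom_mult)
  show "free_flow G X (\<lambda>g. a (\<phi> g))"
    unfolding free_flow_def
  proof (intro ballI equalityI subsetI)
    fix x g assume x: "x \<in> topspace X" and g: "g \<in> {g \<in> carrier G. a (\<phi> g) x = x}"
    then have "\<phi> g \<in> {g \<in> carrier H. a g x = x}" using \<phi>H by simp
    also have "\<dots> = {\<phi> \<one>\<^bsub>G\<^esub>}" using flow(2) x by (simp add: free_flow_def one)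
    finally have "\<phi> g = \<phi> \<one>\<^bsub>G\<^esub>" by simp
    then show "g \<in> {\<one>\<^bsub>G\<^esub>}" using g bij by (auto simp: bij_betw_def dest: inj_onD)
  qed (use flow(1) one in \<open>auto simp: group_flow_def\<close>)
  show "proximal_flow G X (\<lambda>g. a (\<phi> g))"
    unfolding proximal_flow_def
  proof (intro ballI)
    fix x1 x2 assume "x1 \<in> topspace X" "x2 \<in> topspace X"
    then obtain y F where F: "y \<in> topspace X" "F \<noteq> bot" "\<forall>\<^sub>F g in F. g \<in> carrier H"
      "limitin X (\<lambda>g. a g x1) y F" "limitin X (\<lambda>g. a g x2) y F"
      using flow(3) unfolding proximal_flow_def by blast
    \<comment> \<open>The net is pulled back to \<open>G\<close>. Outside the carrier of
      \<open>H\<close> this inverse is arbitrary, but \<open>F\<close> is concentrated on the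
      carrier.\<close>
    let ?\<psi> = "inv_into (carrier G) \<phi>"
    have inv: "\<forall>\<^sub>F g in F. \<phi> (?\<psi> g) = g" "\<forall>\<^sub>F g in F. ?\<psi> g \<in> carrier G"
      using F(3) bij by (auto elim!: eventually_mono simp: bij_betw_def f_inv_into_f inv_into_into)
    have lim: "limitin X (\<lambda>g. a (\<phi> g) x) y (filtermap ?\<psi> F)" if "limitin X (\<lambda>g. a g x) y F" for x
    proof -
      have "limitin X (\<lambda>g. a (\<phi> (?\<psi> g)) x) y F"
        by (rule limitin_transform_eventually[OF _ that]) (use inv(1) in \<open>auto elim!: eventually_mono\<close>)
      then show ?thesis by (simp add: limitin_def eventually_filtermap)
    qed
    show "\<exists>y\<in>topspace X. \<exists>F. F \<noteq> bot \<and> (\<forall>\<^sub>F g in F. g \<in> carrier G) \<and>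
        limitin X (\<lambda>g. a (\<phi> g) x1) y F \<and> limitin X (\<lambda>g. a (\<phi> g) x2) y F"
      using F lim inv(2)
      by (intro bexI[of _ y] exI[of _ "filtermap ?\<psi> F"]) (auto simp: filtermap_bot_iff eventually_filtermap)
  qed
qed

text \<open>A configuration is coded by its graph, a set of natural numbers, and such sets embed
  into the reals.\<close>

lemma inj_configurations_real: "\<exists>f :: (nat \<times> nat \<Rightarrow> nat) \<Rightarrow> real. inj f"
proof -
  obtain j :: "nat set \<Rightarrow> real" where j: "inj j"
    using nat_sets_lepoll_reals01 unfolding lepoll_def by blast
  define graph where "graph z = range (\<lambda>p. prod_encode (prod_encode p, z p))" for z :: "nat \<times> nat \<Rightarrow> nat"
  have "inj graph"
  proof (rule injI, rule ext)
    fix z z' p assume "graph z = graph z'"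
    then have "prod_encode (prod_encode p, z p) \<in> graph z'" unfolding graph_def by blast
    then show "z p = z' p" unfolding graph_def by auto
  qed
  then have "inj (j \<circ> graph)" using j by (simp add: inj_compose)
  then show ?thesis by blast
qed

text \<open>A nontrivial icc group contains an infinite conjugacy class and is thus infinite. If
  countable, it can be renamed so that its carrier is all of \<open>nat\<close>.\<close>

lemma icc_group_nat_copy:
  fixes G :: "('g, 'm) monoid_scheme"
  assumes "countable (carrier G)" "icc_group G" "carrier G \<noteq> {\<one>\<^bsub>G\<^esub>}"
  shows "\<exists>(H :: nat monoid) \<phi>. full_icc_group H \<and> \<phi> \<in> iso G H"
proof -
  interpret G: group G using assms by (simp add: icc_group_def)
  have icc: "infinite {inv\<^bsub>G\<^esub> h \<otimes>\<^bsub>G\<^esub> g \<otimes>\<^bsub>G\<^esub> h | h. h \<in> carrier G}" if "g \<in> carrier G" "g \<noteq> \<one>\<^bsub>G\<^esub>" for g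
    using assms(2) that by (simp add: icc_group_def)
  obtain g\<^sub>0 where g0: "g\<^sub>0 \<in> carrier G" "g\<^sub>0 \<noteq> \<one>\<^bsub>G\<^esub>" using assms(3) by blast
  have "{inv\<^bsub>G\<^esub> h \<otimes>\<^bsub>G\<^esub> g\<^sub>0 \<otimes>\<^bsub>G\<^esub> h | h. h \<in> carrier G} \<subseteq> carrier G" using g0 by auto
  then have inf: "infinite (carrier G)" using icc[OF g0] finite_subset by blast
  define \<phi> where "\<phi> = to_nat_on (carrier G)"
  define \<psi> where "\<psi> = inv_into (carrier G) \<phi>"
  have bij: "bij_betw \<phi> (carrier G) UNIV" unfolding \<phi>_def using assms(1) inf by (rule to_nat_on_infinite)
  have \<phi>\<psi> [simp]: "\<phi> (\<psi> n) = n" and \<psi>G [simp]: "\<psi> n \<in> carrier G" for n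
    using bij by (auto simp: \<psi>_def bij_betw_def f_inv_into_f inv_into_into)
  have \<psi>\<phi> [simp]: "\<psi> (\<phi> g) = g" if "g \<in> carrier G" for g
    using bij that by (auto simp: \<psi>_def bij_betw_def)
  define H :: "nat monoid" where
    "H = \<lparr>carrier = UNIV, monoid.mult = \<lambda>m n. \<phi> (\<psi> m \<otimes>\<^bsub>G\<^esub> \<psi> n), one = \<phi> \<one>\<^bsub>G\<^esub>\<rparr>"
  have Hs [simp]: "carrier H = UNIV" "m \<otimes>\<^bsub>H\<^esub> n = \<phi> (\<psi> m \<otimes>\<^bsub>G\<^esub> \<psi> n)" "\<one>\<^bsub>H\<^esub> = \<phi> \<one>\<^bsub>G\<^esub>" for m n
    by (simp_all add: H_def)
  interpret H: group H
  proof (rule groupI)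
    show "\<exists>y\<in>carrier H. y \<otimes>\<^bsub>H\<^esub> x = \<one>\<^bsub>H\<^esub>" for x
      by (rule bexI[of _ "\<phi> (inv\<^bsub>G\<^esub> \<psi> x)"]) auto
  qed (auto simp: G.m_assoc)
  have inv: "inv\<^bsub>H\<^esub> x = \<phi> (inv\<^bsub>G\<^esub> \<psi> x)" for x by (rule H.inv_equality) auto
  have "full_icc_group H"
  proof
    show "carrier H = UNIV" by simp
    show "\<exists>g. g \<noteq> \<one>\<^bsub>H\<^esub>" using g0 \<psi>\<phi> by (metis G.one_closed Hs(3))
    fix g assume "g \<noteq> \<one>\<^bsub>H\<^esub>"
    then have "\<psi> g \<noteq> \<one>\<^bsub>G\<^esub>" by (metis \<phi>\<psi> Hs(3))
    then have "infinite {inv\<^bsub>G\<^esub> h \<otimes>\<^bsub>G\<^esub> \<psi> g \<otimes>\<^bsub>G\<^esub> h | h. h \<in> carrier G}" by (intro icc) auto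
    moreover have "{inv\<^bsub>G\<^esub> h \<otimes>\<^bsub>G\<^esub> \<psi> g \<otimes>\<^bsub>G\<^esub> h | h. h \<in> carrier G} \<subseteq> \<psi> ` {inv\<^bsub>H\<^esub> h \<otimes>\<^bsub>H\<^esub> g \<otimes>\<^bsub>H\<^esub> h | h. True}"
    proof clarify
      fix h assume h: "h \<in> carrier G"
      have "inv\<^bsub>G\<^esub> h \<otimes>\<^bsub>G\<^esub> \<psi> g \<otimes>\<^bsub>G\<^esub> h = \<psi> (inv\<^bsub>H\<^esub> (\<phi> h) \<otimes>\<^bsub>H\<^esub> g \<otimes>\<^bsub>H\<^esub> \<phi> h)"
        using h by (simp add: inv)
      then show "inv\<^bsub>G\<^esub> h \<otimes>\<^bsub>G\<^esub> \<psi> g \<otimes>\<^bsub>G\<^esub> h \<in> \<psi> ` {inv\<^bsub>H\<^esub> h \<otimes>\<^bsub>H\<^esub> g \<otimes>\<^bsub>H\<^esub> h | h. True}" by blast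
    qed
    ultimately show "infinite {inv\<^bsub>H\<^esub> h \<otimes>\<^bsub>H\<^esub> g \<otimes>\<^bsub>H\<^esub> h | h. True}"
      using finite_subset by blast
  qed
  moreover have "\<phi> \<in> iso G H" unfolding iso_def hom_def using bij by auto
  ultimately show ?thesis by blast
qed

theorem theorem1p5:
  fixes G :: "('g, 'm) monoid_scheme"
  assumes "group G"
    and "countable (carrier G)"
    and "icc_group G"
  shows "\<exists>(X :: real topology) (a :: 'g \<Rightarrow> real \<Rightarrow> real).
           group_flow G X a \<and> free_flow G X a \<and> metrizable_space X \<and> proximal_flow G X a"
proof (cases "carrier G = {\<one>\<^bsub>G\<^esub>}")
  case True
  \<comment> \<open>The trivial group is icc vacuously. One point is a free flow for it, the
    stabilizer being the whole group.\<close>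
  let ?X = "top_of_set {0::real}"
  have "group_flow G ?X (\<lambda>g x. x)"
    using assms(1) unfolding group_flow_def
    by (auto simp: compact_space_subtopology Hausdorff_space_subtopology homeomorphic_map_id[unfolded id_def])
  moreover have "free_flow G ?X (\<lambda>g x. x)" using True by (simp add: free_flow_def)
  moreover have "metrizable_space ?X"
    by (intro metrizable_space_subtopology metrizable_space_euclidean)
  moreover have "proximal_flow G ?X (\<lambda>g x. x)"
    unfolding proximal_flow_def using True
    by (auto intro!: exI[of _ "principal (carrier G)"] simp: principal_eq_bot_iff eventually_principal limitin_def)
  ultimately show ?thesis by blast
next
  case False
  then obtain H :: "nat monoid" and \<phi> where H: "full_icc_group H" "\<phi> \<in> iso G H"
    using icc_group_nat_copy assms by blast
  obtain X :: "(nat \<times> nat \<Rightarrow> nat) topology" and a where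
    Xa: "group_flow H X a" "free_flow H X a" "metrizable_space X" "proximal_flow H X a"
    using group_flow_nat[OF H(1)] by blast
  obtain f :: "(nat \<times> nat \<Rightarrow> nat) \<Rightarrow> real" where "inj f" using inj_configurations_real by blast
  then have "inj_on f (topspace X)" using inj_on_subset by blast
  with flow_transport_group[OF Xa(1,2,4) assms(1) H(2)] Xa(3) show ?thesis
    by (intro flow_transport_space[where f = f]) blast+
qed

end
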